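(* Let $p,q\geq 2$, let $X$ be a based space, and let $f_1,f_2\in \Omega^p(X)$ and $g_1,g_2\in \Omega^q(X)$. Then (1) $[ f_1+ f_2,g_1]\simeq_{ir} [ f_1,g_1]+ [ f_2,g_1]$, (2) $[ f_1,g_1+ g_2]\simeq_{ir} [ f_1,g_1]+ [ f_1,g_2]$.
   Context: All spaces are Hausdorff and maps are continuous and based. $\Omega^m(X)=\Omega^m(X,x_0)$ is the set of maps $(I^m,\partial I^m)\to (X,x_0)$, $I=[0,1]$, identified with based maps $S^m\to X$ via a fixed homeomorphism $I^m/\partial I^m\cong S^m$; $f+g$ is concatenation in the first coordinate. $a_{p,q}:S^{p+q-1}\to S^p\vee S^q$ is the standard (surjective) attaching map of the $(p+q)$-cell of $S^p\times S^q$, i.e. the restriction of the product characteristic map $D^p\times D^q\to S^p\times S^q$ to the boundary. For $f\in\Omega^p(X)$, $g\in\Omega^q(X)$, the Whitehead product of maps is $[f,g]=(f\vee g)\circ a_{p,q}\in\Omega^{p+q-1}(X)$. (The classical bilinearity of the Whitehead product on homotopy classes may be taken as known.) Based maps $f,g:Y\to X$ are image-relative homotopic, written $f\simeq_{ir}g$, if there is a based homotopy $H:Y\times I\to X$ from $f$ to $g$ with $\operatorname{Im}(H)=\operatorname{Im}(f)\cup\operatorname{Im}(g)$. *)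

theory Defs
  imports "HOL-Analysis.Analysis"
begin

text \<open>
  Coordinates in the library's \<^const>\<open>Euclidean_space\<close> are indexed from 0, so ``the first
  coordinate'' is \<open>x 0\<close>.
\<close>

definition cube :: "nat \<Rightarrow> (nat \<Rightarrow> real) topology" where
  "cube m = subtopology (Euclidean_space m) {x. \<forall>i<m. 0 \<le> x i \<and> x i \<le> 1}"

definition cube_boundary :: "nat \<Rightarrow> (nat \<Rightarrow> real) set" where
  "cube_boundary m = {x \<in> topspace (cube m). \<exists>i<m. x i = 0 \<or> x i = 1}"

definition loop_space :: "nat \<Rightarrow> 'a topology \<Rightarrow> 'a \<Rightarrow> ((nat \<Rightarrow> real) \<Rightarrow> 'a) set" where
  "loop_space m X x0 = {f. continuous_map (cube m) X f \<and> (\<forall>x\<in>cube_boundary m. f x = x0)}"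

definition loop_add :: "((nat \<Rightarrow> real) \<Rightarrow> 'a) \<Rightarrow> ((nat \<Rightarrow> real) \<Rightarrow> 'a) \<Rightarrow> (nat \<Rightarrow> real) \<Rightarrow> 'a" where
  "loop_add f g = (\<lambda>x. if x 0 \<le> 1/2 then f (x(0 := 2 * x 0)) else g (x(0 := 2 * x 0 - 1)))"

definition sphere_base :: "nat \<Rightarrow> nat \<Rightarrow> real" where
  "sphere_base m = (\<lambda>i. if i = m then 1 else 0)"

text \<open>
  The fixed homeomorphism $I^m/\partial I^m \cong S^m$ (for $m \ge 1$), given as the quotient map
  $I^m \to S^m$. Rescale $z \in I^m$ to $x = 2z - 1 \in [-1,1]^m$ and let
  $\delta = \prod_i (1 - x_i^2)$, which vanishes exactly on the boundary. Then $u = x/\delta$ is a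
  homeomorphism from the open cube to $R^m$ (it is strictly increasing along rays from the centre),
  and inverse stereographic projection sends $u$ to $(2u, |u|^2 - 1)/(|u|^2 + 1)$. Clearing
  $\delta$ from the denominators gives the formula below, which also makes sense on the boundary
  and sends it to the base point.
\<close>

definition cube_to_sphere :: "nat \<Rightarrow> (nat \<Rightarrow> real) \<Rightarrow> nat \<Rightarrow> real" where
  "cube_to_sphere m z =
    (let x = (\<lambda>i. 2 * z i - 1);
         d = (\<Prod>i<m. 1 - (x i)\<^sup>2);
         N = (\<Sum>i<m. (x i)\<^sup>2)
     in (\<lambda>i. if i < m then 2 * d * x i / (N + d\<^sup>2)
             else if i = m then (N - d\<^sup>2) / (N + d\<^sup>2) else 0))"

text \<open>
  The two directions of the identification of $\Omega^m(X)$ with based maps $S^m \to X$. The choice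
  of preimage in \<open>to_sphere\<close> is immaterial for elements of $\Omega^m(X)$, since these are constant
  on $\partial I^m$, the only nontrivial fibre of \<^const>\<open>cube_to_sphere\<close>.
\<close>

definition to_sphere :: "nat \<Rightarrow> ((nat \<Rightarrow> real) \<Rightarrow> 'a) \<Rightarrow> (nat \<Rightarrow> real) \<Rightarrow> 'a" where
  "to_sphere m f = (\<lambda>y. f (inv_into (topspace (cube m)) (cube_to_sphere m) y))"

definition from_sphere :: "nat \<Rightarrow> ((nat \<Rightarrow> real) \<Rightarrow> 'a) \<Rightarrow> (nat \<Rightarrow> real) \<Rightarrow> 'a" where
  "from_sphere m h = h \<circ> cube_to_sphere m"

text \<open>
  A homeomorphism $S^m \cong \partial I^{m+1}$: apply the linear automorphism
  $y \mapsto (y_0 + y_m, \dots, y_{m-1} + y_m, y_m)$ of $R^{m+1}$, project radially onto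
  $\partial [-1,1]^{m+1}$, and rescale. The linear map is there to send the base point
  $(0,\dots,0,1)$ to the corner $(1,\dots,1)$, which lies in $\partial I^p \times \partial I^q$ for
  every splitting $p + q = m + 1$; this makes the attaching maps below based.
\<close>

definition sphere_to_cube_boundary :: "nat \<Rightarrow> (nat \<Rightarrow> real) \<Rightarrow> nat \<Rightarrow> real" where
  "sphere_to_cube_boundary m y =
    (let w = (\<lambda>i. if i < m then y i + y m else y m);
         r = Max ((\<lambda>i. \<bar>w i\<bar>) ` {..m})
     in (\<lambda>i. if i \<le> m then (1 + w i / r) / 2 else 0))"

definition cube_split :: "nat \<Rightarrow> nat \<Rightarrow> (nat \<Rightarrow> real) \<Rightarrow> (nat \<Rightarrow> real) \<times> (nat \<Rightarrow> real)" where
  "cube_split p q w = (\<lambda>i. if i < p then w i else 0, \<lambda>i. if i < q then w (p + i) else 0)"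

text \<open>
  The cells $D^p$, $D^q$ are modelled by $I^p$, $I^q$, with characteristic maps
  \<^const>\<open>cube_to_sphere\<close>. The wedge $S^p \vee S^q$ is the subspace
  $S^p \times \{*\} \cup \{*\} \times S^q$ of $S^p \times S^q$, and \<open>attaching_map p q\<close> is a map from
  \<open>nsphere (p + q - 1)\<close> onto it.
\<close>

definition attaching_map :: "nat \<Rightarrow> nat \<Rightarrow> (nat \<Rightarrow> real) \<Rightarrow> (nat \<Rightarrow> real) \<times> (nat \<Rightarrow> real)" where
  "attaching_map p q =
    map_prod (cube_to_sphere p) (cube_to_sphere q) \<circ> cube_split p q \<circ> sphere_to_cube_boundary (p + q - 1)"

text \<open>
  The map $f \vee g$ on a wedge regarded as a subspace of a product; \<open>c\<close> is the base point of the
  second factor.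
\<close>

definition wedge_map :: "'c \<Rightarrow> ('b \<Rightarrow> 'a) \<Rightarrow> ('c \<Rightarrow> 'a) \<Rightarrow> 'b \<times> 'c \<Rightarrow> 'a" where
  "wedge_map c f g = (\<lambda>(y, z). if z = c then f y else g z)"

definition whitehead ::
    "nat \<Rightarrow> nat \<Rightarrow> ((nat \<Rightarrow> real) \<Rightarrow> 'a) \<Rightarrow> ((nat \<Rightarrow> real) \<Rightarrow> 'a) \<Rightarrow> (nat \<Rightarrow> real) \<Rightarrow> 'a" where
  "whitehead p q f g =
    from_sphere (p + q - 1)
      (wedge_map (sphere_base q) (to_sphere p f) (to_sphere q g) \<circ> attaching_map p q)"

definition image_rel_homotopic ::
    "'b topology \<Rightarrow> 'b \<Rightarrow> 'a topology \<Rightarrow> 'a \<Rightarrow> ('b \<Rightarrow> 'a) \<Rightarrow> ('b \<Rightarrow> 'a) \<Rightarrow> bool" where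
  "image_rel_homotopic Y y0 X x0 f g \<longleftrightarrow>
    (\<exists>H. continuous_map (prod_topology Y (top_of_set {0..1::real})) X H \<and>
         (\<forall>y\<in>topspace Y. H (y, 0) = f y \<and> H (y, 1) = g y) \<and>
         (\<forall>t\<in>{0..1}. H (y0, t) = x0) \<and>
         H ` (topspace Y \<times> {0..1}) = f ` topspace Y \<union> g ` topspace Y)"

definition loop_ir_homotopic ::
    "nat \<Rightarrow> 'a topology \<Rightarrow> 'a \<Rightarrow> ((nat \<Rightarrow> real) \<Rightarrow> 'a) \<Rightarrow> ((nat \<Rightarrow> real) \<Rightarrow> 'a) \<Rightarrow> bool" where
  "loop_ir_homotopic m X x0 f g \<longleftrightarrow>
    image_rel_homotopic (nsphere m) (sphere_base m) X x0 (to_sphere m f) (to_sphere m g)"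

end

theory Submission
  imports Defs
begin

text \<open>
  Write $\Phi : I^m \to \partial I^{m+1}$, $m = p + q - 1$, for the fixed parametrisation, so that
  $[f,g] = W_{f,g} \circ \Phi$ with $W_{f,g}(u,v) = f(u)$ if $v \in \partial I^q$ and $g(v)$ if
  $u \in \partial I^p$. Cut $I^{m+1}$ in half perpendicularly to coordinate $k$ ($k = 0$ for sums in
  the first variable, $k = p$ for sums in the second). The membrane carries $g$ (resp. $f$), so
  $W_{f_1+f_2,g}$ and the two $W_{f_i,g}$ are restrictions of one map on the union of
  $\partial I^{m+1}$ with the membrane. Up to homotopy $\Phi$ can be replaced by a model in which
  every line of the cube parallel to the first axis runs from the corner edge (where coordinates
  other than $k$ are 1) along the bottom face to a point of the side walls, straight up coordinate
  $k$, and along the top face back to the corner edge. For the sum of the two halves such a line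
  makes in addition a detour into the membrane and back. Both routes live in a comb with three teeth,
  which is contractible, hence they are homotopic inside the image. The corner edge is mapped to the
  base point because $p, q \ge 2$.
\<close>

text \<open>The homotopy must not leave the two images. Every map in the argument has the form W
  composed with a motion of points in the boundary of a cube or in the comb, and W takes values in
  the union of the images of the two loops involved. So the whole argument runs with X replaced by
  that union, and surjectivity of \<Phi> shows that the union is already the image of the left-hand
  side. Maps into the boundary of I^{m+1} are treated as radial projections of nowhere vanishing
  directions in R^{m+1}. Two of them are homotopic once the segment between their directions avoids
  0, so each change of \<Phi> comes down to a few linear equations. Two points are delicate. On the
  boundary of I^m the model does not sit at the corner (1,...,1) but slides along the corner edge,
  so homotopies are kept in that edge instead of being fixed. And sums subdivide coordinate 0
  whereas the membrane cuts coordinate k, so the cube is first rotated; exchanging the two axes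
  would reverse orientation.\<close>

section \<open>The cube as a compact subspace of the product of lines\<close>

lemma topspace_cube: "topspace (cube m) = {z. (\<forall>i<m. 0 \<le> z i \<and> z i \<le> 1) \<and> (\<forall>i\<ge>m. z i = 0)}"
  by (auto simp: cube_def topspace_Euclidean_space)

lemma cube_eq_top_of_set: "cube m = top_of_set (topspace (cube m))"
  by (auto simp: cube_def Euclidean_space_def subtopology_subtopology euclidean_product_topology
      intro!: arg_cong[where f = top_of_set])

lemma cube_boundary_iff:
  "z \<in> cube_boundary m \<longleftrightarrow> z \<in> topspace (cube m) \<and> (\<exists>i<m. z i = 0 \<or> z i = 1)"
  by (auto simp: cube_boundary_def)

lemma continuous_on_coord [continuous_intros]:
  "continuous_on S (\<lambda>z::nat \<Rightarrow> real. z i)"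
  by (rule continuous_on_subset[OF continuous_on_product_coordinates]) simp

lemma compact_topspace_cube: "compact (topspace (cube m))"
proof -
  have "topspace (cube m) = PiE UNIV (\<lambda>i. if i < m then {0..1} else {0})"
    by (force simp: topspace_cube PiE_iff not_less split: if_splits)
  moreover have "compactin (product_topology (\<lambda>i::nat. euclideanreal) UNIV)
      (PiE UNIV (\<lambda>i. if i < m then {0..1} else {0}))"
    by (auto simp: compactin_PiE)
  ultimately show ?thesis
    by (simp add: euclidean_product_topology)
qed

section \<open>The quotient map from the cube to the sphere\<close>

definition bump :: "nat \<Rightarrow> (nat \<Rightarrow> real) \<Rightarrow> real" where
  "bump m z = (\<Prod>i<m. 1 - (2 * z i - 1)\<^sup>2)"

definition centre_dist2 :: "nat \<Rightarrow> (nat \<Rightarrow> real) \<Rightarrow> real" where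
  "centre_dist2 m z = (\<Sum>i<m. (2 * z i - 1)\<^sup>2)"

text \<open>
  In the coordinates $x = 2z - 1$ the map \<^const>\<open>cube_to_sphere\<close> is $x \mapsto (a x, c)$ with
  $a$ = \<open>horiz\<close> and $c$ = \<open>height\<close>.
\<close>

definition horiz :: "nat \<Rightarrow> (nat \<Rightarrow> real) \<Rightarrow> real" where
  "horiz m z = 2 * bump m z / (centre_dist2 m z + (bump m z)\<^sup>2)"

definition height :: "nat \<Rightarrow> (nat \<Rightarrow> real) \<Rightarrow> real" where
  "height m z = (centre_dist2 m z - (bump m z)\<^sup>2) / (centre_dist2 m z + (bump m z)\<^sup>2)"

lemma cube_to_sphere_eq:
  "cube_to_sphere m z =
    (\<lambda>i. if i < m then horiz m z * (2 * z i - 1) else if i = m then height m z else 0)"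
  by (auto simp: cube_to_sphere_def Let_def horiz_def height_def bump_def centre_dist2_def)

lemma bump_factor:
  assumes "z \<in> topspace (cube m)" "i < m"
  shows "0 \<le> 1 - (2 * z i - 1)\<^sup>2" "1 - (2 * z i - 1)\<^sup>2 \<le> 1"
    "1 - (2 * z i - 1)\<^sup>2 = 0 \<longleftrightarrow> z i = 0 \<or> z i = 1"
proof -
  have "1 - (2 * z i - 1)\<^sup>2 = 4 * z i * (1 - z i)"
    by (simp add: power2_eq_square algebra_simps)
  moreover have "0 \<le> z i" "z i \<le> 1" using assms by (auto simp: topspace_cube)
  ultimately show "0 \<le> 1 - (2 * z i - 1)\<^sup>2" "1 - (2 * z i - 1)\<^sup>2 = 0 \<longleftrightarrow> z i = 0 \<or> z i = 1"
    by auto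
qed auto

lemma bump_nonneg: "z \<in> topspace (cube m) \<Longrightarrow> 0 \<le> bump m z"
  unfolding bump_def by (intro prod_nonneg) (use bump_factor in auto)

lemma bump_eq_0_iff: "z \<in> topspace (cube m) \<Longrightarrow> bump m z = 0 \<longleftrightarrow> z \<in> cube_boundary m"
  unfolding bump_def using bump_factor(3)[of z m] by (auto simp: cube_boundary_iff)

lemma centre_dist2_nonneg: "0 \<le> centre_dist2 m z"
  by (simp add: centre_dist2_def sum_nonneg)

lemma centre_dist2_eq_0_iff: "centre_dist2 m z = 0 \<longleftrightarrow> (\<forall>i<m. 2 * z i - 1 = 0)"
  unfolding centre_dist2_def by (subst sum_nonneg_eq_0_iff) auto

text \<open>The two summands never vanish together: \<open>centre_dist2\<close> is 0 only at the
  centre, \<open>bump\<close> only on the boundary.\<close>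

lemma cube_to_sphere_denom_pos:
  assumes "z \<in> topspace (cube m)"
  shows "0 < centre_dist2 m z + (bump m z)\<^sup>2"
proof (cases "z \<in> cube_boundary m")
  case True
  then obtain i where "i < m" "z i = 0 \<or> z i = 1" by (auto simp: cube_boundary_iff)
  then have "centre_dist2 m z \<noteq> 0" unfolding centre_dist2_eq_0_iff by force
  with centre_dist2_nonneg[of m z] show ?thesis by (simp add: add_pos_nonneg)
next
  case False
  with bump_eq_0_iff[OF assms] have "bump m z \<noteq> 0" by simp
  then show ?thesis using centre_dist2_nonneg by (simp add: add_nonneg_pos)
qed

lemma horiz_nonneg: "z \<in> topspace (cube m) \<Longrightarrow> 0 \<le> horiz m z"
  by (simp add: horiz_def bump_nonneg centre_dist2_nonneg)

lemma horiz_eq_0_iff: "z \<in> topspace (cube m) \<Longrightarrow> horiz m z = 0 \<longleftrightarrow> z \<in> cube_boundary m"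
  using cube_to_sphere_denom_pos[of z m] by (simp add: horiz_def bump_eq_0_iff)

lemma height_boundary: "z \<in> cube_boundary m \<Longrightarrow> height m z = 1"
  using cube_to_sphere_denom_pos[of z m] bump_eq_0_iff[of z m]
  by (simp add: height_def cube_boundary_iff)

lemma height_less_1:
  assumes "z \<in> topspace (cube m)" "z \<notin> cube_boundary m"
  shows "height m z < 1"
proof -
  have "bump m z \<noteq> 0" using bump_eq_0_iff assms by blast
  with cube_to_sphere_denom_pos[OF assms(1)] show ?thesis
    by (simp add: height_def divide_simps)
qed

lemma height_centre:
  assumes "\<And>i. i < m \<Longrightarrow> 2 * z i - 1 = 0"
  shows "height m z = - 1"
proof -
  have "bump m z = 1" unfolding bump_def using assms by (intro prod.neutral) auto
  moreover have "centre_dist2 m z = 0" using assms centre_dist2_eq_0_iff by blast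
  ultimately show ?thesis by (simp add: height_def)
qed

lemma continuous_on_bump [continuous_intros]: "continuous_on S (bump m)"
  unfolding bump_def by (intro continuous_intros)

lemma continuous_on_centre_dist2 [continuous_intros]: "continuous_on S (centre_dist2 m)"
  unfolding centre_dist2_def by (intro continuous_intros)

lemma continuous_on_horiz: "continuous_on (topspace (cube m)) (horiz m)"
  unfolding horiz_def using cube_to_sphere_denom_pos
  by (intro continuous_intros) (force simp: less_le)+

lemma continuous_on_height: "continuous_on (topspace (cube m)) (height m)"
  unfolding height_def using cube_to_sphere_denom_pos
  by (intro continuous_intros) (force simp: less_le)+

lemma continuous_on_cube_to_sphere: "continuous_on (topspace (cube m)) (cube_to_sphere m)"
proof (rule continuous_on_coordinatewise_then_product)
  fix i
  consider "i < m" | "i = m" | "m < i" by linarith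
  then show "continuous_on (topspace (cube m)) (\<lambda>z. cube_to_sphere m z i)"
    by cases (auto simp: cube_to_sphere_eq intro!: continuous_intros continuous_on_horiz continuous_on_height)
qed

lemma topspace_nsphere: "topspace (nsphere m) = {y. (\<Sum>i\<le>m. (y i)\<^sup>2) = 1 \<and> (\<forall>i>m. y i = 0)}"
  by (auto simp: nsphere)

lemma nsphere_eq_top_of_set: "nsphere m = top_of_set (topspace (nsphere m))"
  by (simp add: nsphere euclidean_product_topology)

lemma cube_to_sphere_in_nsphere:
  assumes "z \<in> topspace (cube m)"
  shows "cube_to_sphere m z \<in> topspace (nsphere m)"
proof -
  have "(\<Sum>i\<le>m. (cube_to_sphere m z i)\<^sup>2) = (\<Sum>i<m. (horiz m z * (2 * z i - 1))\<^sup>2) + (height m z)\<^sup>2"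
    by (simp add: cube_to_sphere_eq flip: lessThan_Suc_atMost)
  also have "\<dots> = (horiz m z)\<^sup>2 * centre_dist2 m z + (height m z)\<^sup>2"
    by (simp add: centre_dist2_def power_mult_distrib sum_distrib_left)
  also have "\<dots> = 1"
    using cube_to_sphere_denom_pos[OF assms]
    by (simp add: horiz_def height_def power_divide add_divide_distrib[symmetric])
       (simp add: power2_eq_square algebra_simps)
  finally show ?thesis by (auto simp: topspace_nsphere cube_to_sphere_eq)
qed

lemma zero_in_cube_boundary: "m \<ge> 1 \<Longrightarrow> (\<lambda>i. 0) \<in> cube_boundary m"
  by (auto simp: cube_boundary_iff topspace_cube intro!: exI[of _ 0])

lemma cube_to_sphere_eq_base_iff:
  assumes "z \<in> topspace (cube m)"
  shows "cube_to_sphere m z = sphere_base m \<longleftrightarrow> z \<in> cube_boundary m"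
proof
  assume "cube_to_sphere m z = sphere_base m"
  from fun_cong[OF this, of m] have "height m z = 1" by (simp add: cube_to_sphere_eq sphere_base_def)
  then show "z \<in> cube_boundary m" using height_less_1[OF assms] by force
next
  assume "z \<in> cube_boundary m"
  then show "cube_to_sphere m z = sphere_base m"
    using assms horiz_eq_0_iff height_boundary by (auto simp: cube_to_sphere_eq sphere_base_def)
qed

text \<open>Both points lie on one ray, and the one with the smaller bump is not farther from the
  centre. But the bump does not decrease towards the centre, so the two bumps agree.\<close>

lemma cube_to_sphere_inj_interior_aux:
  assumes z: "z \<in> topspace (cube m)" and z': "z' \<in> topspace (cube m)"
    and b: "bump m z > 0" and le: "bump m z \<le> bump m z'"
    and eq: "\<And>i. i < m \<Longrightarrow> (2 * z i - 1) / bump m z = (2 * z' i - 1) / bump m z'"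
  shows "bump m z = bump m z'"
proof -
  have *: "(2 * z i - 1)\<^sup>2 \<le> (2 * z' i - 1)\<^sup>2" if "i < m" for i
  proof -
    have "2 * z i - 1 = bump m z / bump m z' * (2 * z' i - 1)"
      using eq[OF that] b le by (simp add: field_simps)
    moreover have "\<bar>bump m z / bump m z'\<bar> \<le> 1" using b le by simp
    ultimately show ?thesis
      by (metis abs_ge_zero abs_le_square_iff abs_mult mult_left_le_one_le)
  qed
  have "bump m z' \<le> bump m z"
    unfolding bump_def by (rule prod_mono) (use * bump_factor(1)[OF z'] in auto)
  with le show ?thesis by simp
qed

lemma cube_to_sphere_inj_interior:
  assumes z: "z \<in> topspace (cube m)" "z \<notin> cube_boundary m" and z': "z' \<in> topspace (cube m)"
    and eq: "cube_to_sphere m z = cube_to_sphere m z'"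
  shows "z = z'"
proof -
  have z'b: "z' \<notin> cube_boundary m"
    using z z' eq cube_to_sphere_eq_base_iff by metis
  have pos: "bump m z > 0" "bump m z' > 0"
    using z z' z'b bump_nonneg bump_eq_0_iff by (metis less_eq_real_def)+
  \<comment> \<open>y_i / (1 - y_m) is stereographic projection from the base point; by this
    identity it sends the image of x to x / bump.\<close>
  have ratio: "horiz m y / (1 - height m y) = 1 / bump m y" if "y \<in> topspace (cube m)" "bump m y > 0" for y
  proof -
    have "1 - height m y = bump m y * horiz m y"
      using cube_to_sphere_denom_pos[OF that(1)]
      by (simp add: height_def horiz_def field_simps power2_eq_square)
    moreover have "horiz m y \<noteq> 0"
      using that bump_eq_0_iff[OF that(1)] horiz_eq_0_iff[OF that(1)] by auto
    ultimately show ?thesis using that(2) by simp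
  qed
  have hh: "height m z = height m z'"
    using fun_cong[OF eq, of m] by (simp add: cube_to_sphere_eq)
  have coord: "(2 * z i - 1) / bump m z = (2 * z' i - 1) / bump m z'" if "i < m" for i
  proof -
    have "horiz m z * (2 * z i - 1) = horiz m z' * (2 * z' i - 1)"
      using fun_cong[OF eq, of i] that by (simp add: cube_to_sphere_eq)
    then have "horiz m z / (1 - height m z) * (2 * z i - 1) = horiz m z' / (1 - height m z') * (2 * z' i - 1)"
      using hh by simp
    then show ?thesis using ratio z z' pos by simp
  qed
  have "bump m z = bump m z'"
    using cube_to_sphere_inj_interior_aux[of z m z'] cube_to_sphere_inj_interior_aux[of z' m z]
      z z' pos coord by (metis linear)
  then have "z i = z' i" if "i < m" for i using coord[OF that] pos by simp
  moreover have "z i = z' i" if "\<not> i < m" for i using z z' that by (auto simp: topspace_cube)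
  ultimately show ?thesis by blast
qed

lemma cube_to_sphere_surj:
  assumes "m \<ge> 1"
  shows "cube_to_sphere m ` topspace (cube m) = topspace (nsphere m)"
proof (intro equalityI subsetI)
  fix y assume y: "y \<in> topspace (nsphere m)"
  then have ysum: "(\<Sum>i<m. (y i)\<^sup>2) + (y m)\<^sup>2 = 1" and yz: "\<And>i. i > m \<Longrightarrow> y i = 0"
    by (auto simp: topspace_nsphere simp flip: lessThan_Suc_atMost)
  show "y \<in> cube_to_sphere m ` topspace (cube m)"
  proof (cases "y m = 1")
    case True
    then have "(\<Sum>i<m. (y i)\<^sup>2) = 0" using ysum by simp
    then have "\<forall>i<m. y i = 0" by (subst (asm) sum_nonneg_eq_0_iff) auto
    with True yz have "y = sphere_base m"
      by (auto simp: sphere_base_def fun_eq_iff) (metis linorder_neqE_nat)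
    moreover have "(\<lambda>i. 0) \<in> cube_boundary m" using assms by (rule zero_in_cube_boundary)
    ultimately show ?thesis using cube_to_sphere_eq_base_iff
      by (metis cube_boundary_iff image_eqI)
  next
    case False
    have "(y m)\<^sup>2 \<le> 1" using ysum sum_nonneg[of "{..<m}" "\<lambda>i. (y i)\<^sup>2"] by simp
    then have ym: "y m < 1" using False by (simp add: power2_le_iff_abs_le abs_square_le_1)
    \<comment> \<open>Stereographic projection of \<open>y\<close> from the base point.\<close>
    define u where "u i = y i / (1 - y m)" for i
    define M where "M = Max ((\<lambda>i. \<bar>u i\<bar>) ` {..<m})"
    have ne: "{..<m} \<noteq> {}" using assms by (simp add: lessThan_empty_iff)
    have uM: "\<bar>u i\<bar> \<le> M" if "i < m" for i unfolding M_def using that by auto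
    have M0: "0 \<le> M" using uM[of 0] assms by simp
    obtain j where j: "j < m" "M = \<bar>u j\<bar>"
    proof -
      have "M \<in> (\<lambda>i. \<bar>u i\<bar>) ` {..<m}" unfolding M_def using ne by (intro Max_in) auto
      then show ?thesis using that by auto
    qed
    define B where "B t = (\<Prod>i<m. 1 - (t * (u i))\<^sup>2)" for t
    \<comment> \<open>the preimage is $x = t u$ on the ray through the stereographic image $u$ of $y$, where $t$ must equal the bump at $x$\<close>
    have "\<exists>t. 0 \<le> t \<and> t * M \<le> 1 \<and> t = B t"
    proof (cases "M = 0")
      case True
      then have "u i = 0" if "i < m" for i using uM[OF that] by simp
      then have "B 1 = 1" unfolding B_def by (intro prod.neutral) auto
      with True show ?thesis by (intro exI[of _ 1]) auto
    next
      case False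
      then have Mp: "M > 0" using M0 by simp
      have contB: "continuous_on {0..1/M} (\<lambda>t. t - B t)" unfolding B_def by (intro continuous_intros)
      have B0: "B 0 = 1" unfolding B_def by simp
      \<comment> \<open>At t = 1/M the ray leaves the cube: the factor of the coordinate
        \<open>j\<close> attaining \<open>M\<close> vanishes there.\<close>
      have "1 - (1 / M * u j)\<^sup>2 = 0" 
      proof -
        have "(u j)\<^sup>2 = M\<^sup>2" using j(2) by simp
        then show ?thesis using Mp by (simp add: power_divide)
      qed
      then have B1: "B (1/M) = 0" unfolding B_def using j(1) by (metis finite_lessThan lessThan_iff prod_zero)
      have "\<exists>t. 0 \<le> t \<and> t \<le> 1/M \<and> t - B t = 0"
        by (rule IVT') (use contB B0 B1 Mp in auto)
      then obtain t where "0 \<le> t" "t \<le> 1/M" "t - B t = 0" by blast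
      then show ?thesis using Mp by (intro exI[of _ t]) (auto simp: field_simps)
    qed
    then obtain t where t: "0 \<le> t" "t * M \<le> 1" "t = B t" by blast
    define z where "z = (\<lambda>i. if i < m then (1 + t * u i) / 2 else 0)"
    have x: "2 * z i - 1 = t * u i" if "i < m" for i using that by (simp add: z_def field_simps)
    have "\<bar>t * u i\<bar> \<le> 1" if "i < m" for i
      using uM[OF that] t by (simp add: abs_mult) (meson mult_left_mono order_trans)
    then have zc: "z \<in> topspace (cube m)"
      by (force simp: topspace_cube z_def abs_le_iff)
    have bz: "bump m z = t" unfolding bump_def by (subst t(3)) (simp add: B_def x)
    have "t \<noteq> 0"
    proof
      assume "t = 0"
      then have "B t = 1" unfolding B_def by simp
      with t(3) \<open>t = 0\<close> show False by simp
    qed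
    have Nz: "centre_dist2 m z = t\<^sup>2 * (\<Sum>i<m. (u i)\<^sup>2)"
      unfolding centre_dist2_def by (simp add: x power_mult_distrib sum_distrib_left)
    have "(\<Sum>i<m. (u i)\<^sup>2) = (\<Sum>i<m. (y i)\<^sup>2) / (1 - y m)\<^sup>2"
      by (simp add: u_def power_divide sum_divide_distrib)
    also have "\<dots> = (1 - (y m)\<^sup>2) / (1 - y m)\<^sup>2" using ysum by (metis add_diff_cancel_right')
    also have "\<dots> = (1 + y m) / (1 - y m)"
      using ym by (simp add: power2_eq_square divide_simps) (simp add: algebra_simps)
    finally have su: "(\<Sum>i<m. (u i)\<^sup>2) = (1 + y m) / (1 - y m)" .
    have den: "centre_dist2 m z + (bump m z)\<^sup>2 = t\<^sup>2 * (2 / (1 - y m))"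
      unfolding Nz bz su using ym by (simp add: field_simps)
    have num: "centre_dist2 m z - (bump m z)\<^sup>2 = t\<^sup>2 * (2 * y m / (1 - y m))"
      unfolding Nz bz su using ym by (simp add: field_simps)
    have "height m z = y m" unfolding height_def den num using \<open>t \<noteq> 0\<close> ym by simp
    moreover have "horiz m z = (1 - y m) / t"
      unfolding horiz_def den using \<open>t \<noteq> 0\<close> ym by (simp add: bz power2_eq_square)
    ultimately have "cube_to_sphere m z = y"
      using \<open>t \<noteq> 0\<close> ym yz x by (auto simp: cube_to_sphere_eq fun_eq_iff u_def)
    then show ?thesis using zc by blast
  qed
qed (use cube_to_sphere_in_nsphere in blast)

lemma inv_cube_to_sphere:
  assumes "z \<in> topspace (cube m)" "\<And>z. z \<in> cube_boundary m \<Longrightarrow> f z = c"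
  shows "f (inv_into (topspace (cube m)) (cube_to_sphere m) (cube_to_sphere m z)) = f z"
proof -
  let ?w = "inv_into (topspace (cube m)) (cube_to_sphere m) (cube_to_sphere m z)"
  have w: "?w \<in> topspace (cube m)" "cube_to_sphere m ?w = cube_to_sphere m z"
    using assms(1) by (simp_all add: inv_into_into f_inv_into_f)
  show ?thesis
  proof (cases "z \<in> cube_boundary m")
    case True
    then have "?w \<in> cube_boundary m" using w assms(1) cube_to_sphere_eq_base_iff by metis
    then show ?thesis using True assms(2) by metis
  next
    case False
    then show ?thesis using w assms(1) cube_to_sphere_inj_interior by metis
  qed
qed

section \<open>From homotopies on the cube to homotopies on the sphere\<close>

text \<open>The map from interval times cube to sphere times interval is a continuous surjection
  from a compact onto a Hausdorff space, hence a quotient map, so a homotopy constant on the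
  boundary descends. Working in the subspace \<open>B\<close> bounds the image of the homotopy from
  above; its two ends bound it from below.\<close>

lemma loop_ir_homotopicI:
  assumes m: "m \<ge> 1"
    and hom: "homotopic_with (\<lambda>h. \<forall>z\<in>cube_boundary m. h z = x0) (cube m) (subtopology X B) F G"
    and B: "B \<subseteq> F ` topspace (cube m) \<union> G ` topspace (cube m)"
  shows "loop_ir_homotopic m X x0 F G"
proof -
  let ?C = "topspace (cube m)" and ?q = "cube_to_sphere m"
  let ?inv = "inv_into ?C ?q"
  let ?I = "top_of_set {0..1::real}"
  obtain h where ch: "continuous_map (prod_topology ?I (cube m)) (subtopology X B) h"
    and h0: "\<And>z. h (0, z) = F z" and h1: "\<And>z. h (1, z) = G z"
    and hb: "\<And>t z. t \<in> {0..1} \<Longrightarrow> z \<in> cube_boundary m \<Longrightarrow> h (t, z) = x0"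
    using hom unfolding homotopic_with_def by auto
  have desc: "h (t, ?inv (?q z)) = h (t, z)" if "t \<in> {0..1}" "z \<in> ?C" for t z
    using inv_cube_to_sphere[OF that(2), of "\<lambda>z. h (t, z)"] hb[OF that(1)] by blast
  define H where "H = (\<lambda>(y, t). h (t, ?inv y))"
  \<comment> \<open>Time comes first in \<open>homotopic_with\<close> but last in
    \<open>image_rel_homotopic\<close>, hence the exchange of factors.\<close>
  define Q where "Q = (\<lambda>(t::real, z). (?q z, t))"
  have eqI: "prod_topology ?I (cube m) = top_of_set ({0..1} \<times> ?C)"
    by (subst cube_eq_top_of_set) simp
  have eqS: "prod_topology (nsphere m) ?I = top_of_set (topspace (nsphere m) \<times> {0..1})"
    by (subst nsphere_eq_top_of_set) simp
  have imQ: "Q ` ({0..1} \<times> ?C) = topspace (nsphere m) \<times> {0..1}"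
    unfolding cube_to_sphere_surj[OF m, symmetric] Q_def by force
  have contQ: "continuous_on ({0..1} \<times> ?C) Q"
    unfolding Q_def split_def
    by (intro continuous_on_Pair continuous_on_fst continuous_on_id
        continuous_on_compose2[OF continuous_on_cube_to_sphere] continuous_on_snd) auto
  have "compact ({0..1::real} \<times> ?C)"
    by (intro compact_Times compact_topspace_cube) simp
  then have "closed_map (top_of_set ({0..1} \<times> ?C)) (top_of_set (topspace (nsphere m) \<times> {0..1})) Q"
    using contQ imQ by (intro continuous_imp_closed_map)
      (auto simp: compact_space_subtopology Hausdorff_space_subtopology)
  then have "quotient_map (top_of_set ({0..1} \<times> ?C)) (top_of_set (topspace (nsphere m) \<times> {0..1})) Q"
    using contQ imQ by (intro continuous_closed_imp_quotient_map) auto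
  moreover have "continuous_map (top_of_set ({0..1} \<times> ?C)) X (H \<circ> Q)"
  proof (rule continuous_map_eq)
    show "continuous_map (top_of_set ({0..1} \<times> ?C)) X h"
      using ch by (simp add: eqI continuous_map_in_subtopology)
    show "h x = (H \<circ> Q) x" if "x \<in> topspace (top_of_set ({0..1} \<times> ?C))" for x
      using that desc by (auto simp: H_def Q_def)
  qed
  ultimately have cH: "continuous_map (prod_topology (nsphere m) ?I) X H"
    unfolding eqS by (rule continuous_compose_quotient_map)
  have inv_in: "?inv y \<in> ?C" if "y \<in> topspace (nsphere m)" for y
    using that cube_to_sphere_surj[OF m] by (metis inv_into_into)
  have imB: "H ` (topspace (nsphere m) \<times> {0..1}) \<subseteq> B"
  proof -
    have "h (t, z) \<in> B" if "t \<in> {0..1}" "z \<in> ?C" for t z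
      using continuous_map_image_subset_topspace[OF ch] that by (auto simp: image_subset_iff)
    then show ?thesis using inv_in by (auto simp: H_def)
  qed
  have im: "to_sphere m K ` topspace (nsphere m) = K ` ?C" if "\<And>z. z \<in> cube_boundary m \<Longrightarrow> K z = x0" for K
    unfolding to_sphere_def cube_to_sphere_surj[OF m, symmetric] image_image
    using inv_cube_to_sphere[where f = K and c = x0 and m = m] that by (intro image_cong) auto
  have imF: "to_sphere m F ` topspace (nsphere m) = F ` ?C"
    using hb[of 0] h0 by (intro im) auto
  have imG: "to_sphere m G ` topspace (nsphere m) = G ` ?C"
    using hb[of 1] h1 by (intro im) auto
  have endp: "H (y, 0) = to_sphere m F y" "H (y, 1) = to_sphere m G y" for y
    by (simp_all add: H_def to_sphere_def h0 h1)
  have base: "?inv (sphere_base m) \<in> cube_boundary m"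
  proof -
    have "(\<lambda>i. 0) \<in> cube_boundary m" using m by (rule zero_in_cube_boundary)
    then have "sphere_base m \<in> ?q ` ?C" using cube_to_sphere_eq_base_iff
      by (metis cube_boundary_iff image_eqI)
    then show ?thesis using cube_to_sphere_eq_base_iff by (metis f_inv_into_f inv_into_into)
  qed
  have "to_sphere m F ` topspace (nsphere m) \<union> to_sphere m G ` topspace (nsphere m)
      \<subseteq> H ` (topspace (nsphere m) \<times> {0..1})"
    unfolding endp[symmetric] by force
  then have "H ` (topspace (nsphere m) \<times> {0..1}) =
      to_sphere m F ` topspace (nsphere m) \<union> to_sphere m G ` topspace (nsphere m)"
    using imB B imF imG by blast
  then show ?thesis
    unfolding loop_ir_homotopic_def image_rel_homotopic_def
    using cH endp hb[OF _ base] by (intro exI[of _ H]) (auto simp: H_def)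
qed

section \<open>Radial projection to the boundary of the cube\<close>

definition max_norm :: "nat \<Rightarrow> (nat \<Rightarrow> real) \<Rightarrow> real" where
  "max_norm m w = Max ((\<lambda>i. \<bar>w i\<bar>) ` {..m})"

text \<open>The last stage of \<open>sphere_to_cube_boundary\<close> as a function of the direction
  \<open>w\<close> alone, so that directions can be deformed linearly before projecting.\<close>

definition radial :: "nat \<Rightarrow> (nat \<Rightarrow> real) \<Rightarrow> nat \<Rightarrow> real" where
  "radial m w = (\<lambda>i. if i \<le> m then (1 + w i / max_norm m w) / 2 else 0)"

lemma abs_le_max_norm: "i \<le> m \<Longrightarrow> \<bar>w i\<bar> \<le> max_norm m w"
  by (simp add: max_norm_def)

lemma max_norm_attained: "\<exists>i\<le>m. \<bar>w i\<bar> = max_norm m w"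
proof -
  have "max_norm m w \<in> (\<lambda>i. \<bar>w i\<bar>) ` {..m}"
    unfolding max_norm_def by (intro Max_in) auto
  then show ?thesis by auto
qed

lemma max_norm_pos: "i \<le> m \<Longrightarrow> w i \<noteq> 0 \<Longrightarrow> 0 < max_norm m w"
  using abs_le_max_norm[of i m w] by linarith

lemma max_norm_eq_1:
  assumes "\<And>i. i \<le> m \<Longrightarrow> \<bar>w i\<bar> \<le> 1" "j \<le> m" "\<bar>w j\<bar> = 1"
  shows "max_norm m w = 1"
  using max_norm_attained[of m w] abs_le_max_norm[of j m w] assms by fastforce

lemma continuous_on_max_norm: "continuous_on S (max_norm m)"
proof (induction m)
  case 0
  show ?case by (simp add: max_norm_def) (intro continuous_intros)
next
  case (Suc m)
  have "max_norm (Suc m) w = max \<bar>w (Suc m)\<bar> (max_norm m w)" for w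
    unfolding max_norm_def by (simp add: atMost_Suc)
  then show ?case using Suc by (simp add: fun_eq_iff) (intro continuous_intros)
qed

lemma continuous_on_radial: "continuous_on {w. \<exists>i\<le>m. w i \<noteq> 0} (radial m)"
proof (rule continuous_on_coordinatewise_then_product)
  fix i
  show "continuous_on {w. \<exists>i\<le>m. w i \<noteq> 0} (\<lambda>w. radial m w i)"
    using max_norm_pos unfolding radial_def
    by (cases "i \<le> m") (force intro!: continuous_intros continuous_on_max_norm)+
qed

lemma radial_in_cube_boundary:
  assumes "i \<le> m" "w i \<noteq> 0"
  shows "radial m w \<in> cube_boundary (Suc m)"
proof -
  have pos: "0 < max_norm m w" using assms by (rule max_norm_pos)
  have le: "\<bar>w j / max_norm m w\<bar> \<le> 1" if "j \<le> m" for j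
    using abs_le_max_norm[OF that] pos by simp
  obtain j where j: "j \<le> m" "\<bar>w j\<bar> = max_norm m w" using max_norm_attained by blast
  then have "w j / max_norm m w = 1 \<or> w j / max_norm m w = - 1" 
    using pos by (cases "w j \<ge> 0") (auto simp: divide_eq_minus_1_iff)
  then have "radial m w j = 0 \<or> radial m w j = 1" using j by (auto simp: radial_def)
  moreover have "0 \<le> radial m w i \<and> radial m w i \<le> 1" if "i \<le> m" for i
    using le[OF that] that unfolding abs_le_iff by (simp add: radial_def)
  ultimately show ?thesis using j by (force simp: cube_boundary_iff topspace_cube radial_def)
qed

text \<open>Any map into the boundary thus becomes the projection of a direction, so the model can
  be compared with \<Phi> along segments.\<close>

lemma radial_rescale:
  assumes "p \<in> cube_boundary (Suc m)"
  shows "radial m (\<lambda>i. 2 * p i - 1) = p"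
proof -
  have p: "\<And>i. i \<le> m \<Longrightarrow> 0 \<le> p i \<and> p i \<le> 1" "\<And>i. i > m \<Longrightarrow> p i = 0"
    using assms by (auto simp: cube_boundary_iff topspace_cube)
  obtain j where "j \<le> m" "p j = 0 \<or> p j = 1" using assms by (auto simp: cube_boundary_iff less_Suc_eq_le)
  then have "max_norm m (\<lambda>i. 2 * p i - 1) = 1"
    using p by (intro max_norm_eq_1[of _ _ j]) (auto simp: abs_le_iff)
  then show ?thesis using p by (auto simp: radial_def fun_eq_iff not_le)
qed

section \<open>Directions that project to the parametrisation, and their linear deformation\<close>

text \<open>This is \<Phi> of the overview.\<close>

definition boundary_param :: "nat \<Rightarrow> (nat \<Rightarrow> real) \<Rightarrow> nat \<Rightarrow> real" where
  "boundary_param m = sphere_to_cube_boundary m \<circ> cube_to_sphere m"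

text \<open>
  The direction whose radial projection is \<open>boundary_param m z\<close> when $x = 2z - 1$. A separate
  argument $x$ allows rotating the cube without changing the coefficients.
\<close>

definition sheared :: "nat \<Rightarrow> (nat \<Rightarrow> real) \<Rightarrow> (nat \<Rightarrow> real) \<Rightarrow> nat \<Rightarrow> real" where
  "sheared m x z = (\<lambda>j. (if j < m then horiz m z * x j else 0) + height m z)"

lemma boundary_param_eq: "boundary_param m z = radial m (sheared m (\<lambda>i. 2 * z i - 1) z)"
proof -
  have "max_norm m (\<lambda>i. if i < m then cube_to_sphere m z i + cube_to_sphere m z m else cube_to_sphere m z m)
    = max_norm m (sheared m (\<lambda>i. 2 * z i - 1) z)"
    unfolding max_norm_def by (intro arg_cong[of _ _ Max] image_cong) (auto simp: sheared_def cube_to_sphere_eq)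
  then show ?thesis
    unfolding boundary_param_def comp_def sphere_to_cube_boundary_def Let_def radial_def fun_eq_iff
    by (auto simp: sheared_def cube_to_sphere_eq max_norm_def)
qed

lemma sheared_boundary:
  assumes "z \<in> cube_boundary m"
  shows "sheared m x z j = 1"
  using assms horiz_eq_0_iff height_boundary by (auto simp: sheared_def cube_boundary_iff)

lemma continuous_on_sheared:
  assumes "\<And>j. continuous_on (topspace (cube m)) (\<lambda>z. x z j)"
  shows "continuous_on (topspace (cube m)) (\<lambda>z. sheared m (x z) z)"
proof (rule continuous_on_coordinatewise_then_product)
  fix j
  show "continuous_on (topspace (cube m)) (\<lambda>z. sheared m (x z) z j)"
    unfolding sheared_def
    by (cases "j < m") (auto intro!: continuous_on_add continuous_on_mult continuous_on_const continuous_on_horiz continuous_on_height assms)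
qed

text \<open>The homotopy projects the segment from \<open>P\<close> to \<open>Q\<close>. Over the
  boundary of the cube all coordinates but k stay 1 and none exceeds 1 in absolute value. So the
  norm is 1 and projection keeps these coordinates: the point stays in the corner edge, where
  \<open>W\<close> is \<open>x0\<close>.\<close>

lemma radial_homotopic:
  assumes W: "continuous_map (top_of_set (cube_boundary (Suc m))) X W"
    and edge: "\<And>w. w \<in> cube_boundary (Suc m) \<Longrightarrow> (\<And>j. j \<le> m \<Longrightarrow> j \<noteq> k \<Longrightarrow> w j = 1) \<Longrightarrow> W w = x0"
    and k: "k < m"
    and cP: "continuous_on (topspace (cube m)) P" and cQ: "continuous_on (topspace (cube m)) Q"
    and bdP: "\<And>z j. z \<in> cube_boundary m \<Longrightarrow> j \<le> m \<Longrightarrow> \<bar>P z j\<bar> \<le> 1 \<and> (j \<noteq> k \<longrightarrow> P z j = 1)"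
    and bdQ: "\<And>z j. z \<in> cube_boundary m \<Longrightarrow> j \<le> m \<Longrightarrow> \<bar>Q z j\<bar> \<le> 1 \<and> (j \<noteq> k \<longrightarrow> Q z j = 1)"
    and nz: "\<And>z t. z \<in> topspace (cube m) \<Longrightarrow> z \<notin> cube_boundary m \<Longrightarrow> 0 \<le> t \<Longrightarrow> t \<le> 1 \<Longrightarrow>
      \<exists>j\<le>m. (1 - t) * P z j + t * Q z j \<noteq> 0"
  shows "homotopic_with (\<lambda>h. \<forall>z\<in>cube_boundary m. h z = x0) (cube m) X
    (\<lambda>z. W (radial m (P z))) (\<lambda>z. W (radial m (Q z)))"
proof -
  let ?C = "topspace (cube m)"
  define L where "L = (\<lambda>(t::real, z) j. (1 - t) * P z j + t * Q z j)"
  have bdL: "\<bar>L (t, z) j\<bar> \<le> 1 \<and> (j \<noteq> k \<longrightarrow> L (t, z) j = 1)"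
    if "z \<in> cube_boundary m" "t \<in> {0..1}" "j \<le> m" for t z j
  proof -
    have "\<bar>L (t, z) j\<bar> \<le> (1 - t) * \<bar>P z j\<bar> + t * \<bar>Q z j\<bar>"
      using that abs_triangle_ineq[of "(1 - t) * P z j" "t * Q z j"] by (simp add: L_def abs_mult)
    also have "\<dots> \<le> 1"
      using bdP[OF that(1,3)] bdQ[OF that(1,3)] that(2) by (intro convex_bound_le) auto
    finally show ?thesis using bdP[OF that(1,3)] bdQ[OF that(1,3)] by (simp add: L_def)
  qed
  have nzL: "\<exists>j\<le>m. L (t, z) j \<noteq> 0" if "z \<in> ?C" "t \<in> {0..1}" for t z
  proof (cases "z \<in> cube_boundary m")
    case True
    \<comment> \<open>As k < m, the last coordinate is among those kept at 1.\<close>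
    then have "L (t, z) m = 1" using bdL[OF True that(2), of m] k by simp
    then show ?thesis by (intro exI[of _ m]) simp
  next
    case False
    then show ?thesis using nz[OF that(1) False] that(2) by (auto simp: L_def)
  qed
  have contL: "continuous_on ({0..1} \<times> ?C) L"
  proof (rule continuous_on_coordinatewise_then_product)
    fix j
    have "continuous_on ({0..1} \<times> ?C) (\<lambda>y::real \<times> (nat \<Rightarrow> real). P (snd y) j)"
      "continuous_on ({0..1} \<times> ?C) (\<lambda>y::real \<times> (nat \<Rightarrow> real). Q (snd y) j)"
      by (rule continuous_on_product_then_coordinatewise, rule continuous_on_compose2[OF cP],
          auto intro: continuous_on_snd)
        (rule continuous_on_product_then_coordinatewise, rule continuous_on_compose2[OF cQ],
          auto intro: continuous_on_snd)
    then show "continuous_on ({0..1} \<times> ?C) (\<lambda>y. L y j)"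
      unfolding L_def split_def by (intro continuous_intros)
  qed
  have "continuous_map (top_of_set ({0..1} \<times> ?C)) (top_of_set (cube_boundary (Suc m))) (\<lambda>y. radial m (L y))"
    using nzL radial_in_cube_boundary[of _ m]
    by (auto intro!: continuous_on_compose2[OF continuous_on_radial contL]) blast
  from continuous_map_compose[OF this W]
  have cont: "continuous_map (prod_topology (top_of_set {0..1}) (cube m)) X (\<lambda>y. W (radial m (L y)))"
    by (subst cube_eq_top_of_set) (simp add: comp_def)
  have const: "W (radial m (L (t, z))) = x0" if "z \<in> cube_boundary m" "t \<in> {0..1}" for t z
  proof (rule edge)
    have Lm: "L (t, z) m = 1" using bdL[OF that, of m] k by simp
    show "radial m (L (t, z)) \<in> cube_boundary (Suc m)" by (rule radial_in_cube_boundary[of m]) (simp_all add: Lm)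
    have "max_norm m (L (t, z)) = 1"
      by (rule max_norm_eq_1[of _ _ m]) (use bdL[OF that] Lm in auto)
    then show "radial m (L (t, z)) j = 1" if "j \<le> m" "j \<noteq> k" for j
      using bdL[OF \<open>z \<in> cube_boundary m\<close> \<open>t \<in> {0..1}\<close> that(1)] that by (simp add: radial_def)
  qed
  show ?thesis
    unfolding homotopic_with_def using cont const
    by (intro exI[of _ "\<lambda>y. W (radial m (L y))"]) (auto simp: L_def)
qed

section \<open>The comb and the two routes\<close>

text \<open>The spine r = 1 stands for the side wall, the teeth t = 0, 1/2, 1 for the bottom face,
  the membrane and the top face.\<close>

definition comb :: "(real \<times> real) set" where
  "comb = {(t, r). t \<in> {0..1} \<and> r \<in> {0..1} \<and> (r = 1 \<or> t = 0 \<or> t = 1/2 \<or> t = 1)}"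

text \<open>The route stays on the bottom face until s = 1/2, climbs until s = 3/4 and returns along
  the top face. With this timing \<open>route_t s + route_r s - 1\<close> never has the sign
  opposite to s - 1/2. At s = 1/2 the route is at the foot of the wall, so the centre of the cube
  goes to the corner (0,...,0), as under \<Phi>.\<close>

definition route_t :: "real \<Rightarrow> real" where "route_t s = max 0 (min 1 (4 * s - 2))"

definition route_r :: "real \<Rightarrow> real" where "route_r s = min (min (2 * s) 1) (4 - 4 * s)"

text \<open>Slide the teeth up to the spine, then shrink the spine to a point.\<close>

lemma contractible_comb: "contractible comb"
proof -
  let ?f = "\<lambda>p::real \<times> real. (fst p, 1::real)"
  have "closed_segment (id p) (?f p) \<subseteq> comb" "closed_segment (?f p) (1/2, 1) \<subseteq> comb" if "p \<in> comb" for p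
    using that by (auto simp: comb_def closed_segment_eq_real_ivl split: if_splits dest!: closed_segment_PairD)
  then have 1: "homotopic_with_canon (\<lambda>_. True) comb comb id ?f"
    and 2: "homotopic_with_canon (\<lambda>_. True) comb comb ?f (\<lambda>_. (1/2, 1))"
    by (intro homotopic_with_linear continuous_intros continuous_on_id'; simp)+
  show ?thesis
    unfolding contractible_def using homotopic_with_trans[OF 1 2] by blast
qed

lemma route_in:
  assumes "s \<in> {0..1}"
  shows "route_t s \<in> {0..1}" "route_r s \<in> {0..1}" "route_r s = 1 \<or> route_t s = 0 \<or> route_t s = 1"
  using assms by (auto simp: route_t_def route_r_def min_def max_def)

lemma route_ends: "route_t 0 = 0" "route_r 0 = 0" "route_t 1 = 1" "route_r 1 = 0"
  by (auto simp: route_t_def route_r_def)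

lemma continuous_on_route: "continuous_on S route_t" "continuous_on S route_r"
  unfolding route_t_def route_r_def by (intro continuous_intros)+

text \<open>The second path runs the route once in each half of the comb, so in the middle it
  descends the tooth at 1/2 and climbs it again. In a simply connected space equal end points
  suffice.\<close>

lemma route_homotopic:
  "homotopic_paths comb (\<lambda>s. (route_t s, route_r s))
    ((\<lambda>s. (route_t s / 2, route_r s)) +++ (\<lambda>s. ((1 + route_t s) / 2, route_r s)))"
proof -
  let ?p = "\<lambda>s. (route_t s, route_r s)"
  let ?q = "\<lambda>s. (route_t s / 2, route_r s)" and ?q' = "\<lambda>s. ((1 + route_t s) / 2, route_r s)"
  have "path ?p" "path ?q" "path ?q'"
    unfolding path_def by (intro continuous_intros continuous_on_route; simp)+
  moreover have "path_image ?p \<subseteq> comb" "path_image ?q \<subseteq> comb" "path_image ?q' \<subseteq> comb"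
    using route_in by (fastforce simp: path_image_def comb_def)+
  moreover have "pathfinish ?q = pathstart ?q'"
    by (simp add: pathfinish_def pathstart_def route_ends)
  ultimately have "path (?q +++ ?q')" "path_image (?q +++ ?q') \<subseteq> comb"
    by (simp_all add: path_image_join)
  moreover have "pathstart (?q +++ ?q') = pathstart ?p" "pathfinish (?q +++ ?q') = pathfinish ?p"
    by (simp_all add: pathstart_def pathfinish_def joinpaths_def route_ends)
  ultimately show ?thesis
    using contractible_imp_simply_connected[OF contractible_comb] \<open>path ?p\<close> \<open>path_image ?p \<subseteq> comb\<close>
    unfolding simply_connected_eq_homotopic_paths by blast
qed

section \<open>A model for the parametrisation of the boundary\<close>

text \<open>
  A quarter turn in the plane of coordinates 0 and $k$ (the identity for $k = 0$). It makes $z_0$ the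
  parameter along coordinate $k$ without reversing orientation.
\<close>

definition turn :: "nat \<Rightarrow> (nat \<Rightarrow> real) \<Rightarrow> nat \<Rightarrow> real" where
  "turn k z = (\<lambda>j. if j = k then 2 * z 0 - 1 else if j = 0 then 1 - 2 * z k else 2 * z j - 1)"

text \<open>\<open>bump\<close> of a cross-section perpendicular to axis 0: the omitted slot k is
  the only one where \<open>turn\<close> puts z 0.\<close>

definition side_bump :: "nat \<Rightarrow> nat \<Rightarrow> (nat \<Rightarrow> real) \<Rightarrow> real" where
  "side_bump m k z = (\<Prod>j\<in>{..<m} - {k}. 1 - (turn k z j)\<^sup>2)"

text \<open>The analogue of \<open>sheared\<close> one dimension lower, with \<open>horiz\<close>
  and \<open>height\<close> replaced by B and 1 - 2B for the side bump B; the latter runs from 1 on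
  the sides to -1 at the centre. Slot k merely copies the last coordinate.\<close>

definition side_dir :: "nat \<Rightarrow> nat \<Rightarrow> (nat \<Rightarrow> real) \<Rightarrow> nat \<Rightarrow> real" where
  "side_dir m k z = (\<lambda>j. (if j < m \<and> j \<noteq> k then side_bump m k z * turn k z j else 0)
     + (1 - 2 * side_bump m k z))"

text \<open>
  The point \<open>(t, r)\<close> of the comb gives the position in coordinate $k$ and the contraction towards
  the corner edge: $r = 1$ is the side wall, $r = 0$ the corner edge.
\<close>

definition model :: "nat \<Rightarrow> nat \<Rightarrow> real \<times> real \<Rightarrow> (nat \<Rightarrow> real) \<Rightarrow> nat \<Rightarrow> real" where
  "model m k tr z = (\<lambda>j. if j = k then fst tr
     else if j \<le> m then 1 + snd tr * (radial m (side_dir m k z) j - 1) else 0)"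

definition route :: "real \<Rightarrow> real \<times> real" where "route s = (route_t s, route_r s)"

context
  fixes m k :: nat
  assumes k: "k < m"
begin

lemma side_bump_pos:
  assumes "z \<in> topspace (cube m)" "z \<notin> cube_boundary m"
  shows "0 < side_bump m k z"
proof -
  have b: "0 < z i \<and> z i < 1" if "i < m" for i
    using assms that by (force simp: topspace_cube cube_boundary_iff less_le)
  have "\<bar>turn k z j\<bar> < 1" if "j < m" for j
    using b[of 0] b[of k] b[OF that] that k by (auto simp: turn_def abs_less_iff)
  then show ?thesis unfolding side_bump_def by (intro prod_pos) (auto simp: abs_square_less_1)
qed

lemma side_bump_boundary:
  assumes "z \<in> cube_boundary m" "z 0 \<noteq> 0" "z 0 \<noteq> 1"
  shows "side_bump m k z = 0"
proof -
  obtain i where i: "i < m" "z i = 0 \<or> z i = 1" using assms(1) by (auto simp: cube_boundary_iff)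
  then have i0: "i \<noteq> 0" using assms by metis
  have "\<exists>j\<in>{..<m} - {k}. (turn k z j)\<^sup>2 = 1"
  \<comment> \<open>The quarter turn moves z k to slot 0; a coordinate other than 0 and k keeps its
    slot.\<close>
  proof (cases "i = k")
    case True
    then show ?thesis using i i0 by (intro bexI[of _ 0]) (auto simp: turn_def)
  next
    case False
    then show ?thesis using i i0 by (intro bexI[of _ i]) (auto simp: turn_def)
  qed
  then show ?thesis unfolding side_bump_def by (auto intro!: prod_zero)
qed

text \<open>The last coordinate vanishes only for side bump 1/2; then the others vanish only at the
  centre, where the side bump is 1.\<close>

lemma side_dir_nonzero: "\<exists>j\<le>m. side_dir m k z j \<noteq> 0"
proof (rule ccontr)
  assume "\<not> ?thesis"
  then have zero: "side_dir m k z j = 0" if "j \<le> m" for j using that by blast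
  have B: "side_bump m k z = 1/2" using zero[of m] by (simp add: side_dir_def)
  have "turn k z j = 0" if "j < m" "j \<noteq> k" for j
    using zero[of j] that B by (simp add: side_dir_def)
  then have "side_bump m k z = 1" unfolding side_bump_def by (intro prod.neutral) auto
  with B show False by simp
qed

lemma radial_side_dir: "radial m (side_dir m k z) \<in> cube_boundary (Suc m)"
  using side_dir_nonzero radial_in_cube_boundary by blast

lemma radial_side_dir_boundary:
  assumes "z \<in> cube_boundary m" "z 0 \<noteq> 0" "z 0 \<noteq> 1" "j \<le> m"
  shows "radial m (side_dir m k z) j = 1"
proof -
  have one: "side_dir m k z i = 1" for i
    using side_bump_boundary[OF assms(1-3)] by (simp add: side_dir_def)
  then have "max_norm m (side_dir m k z) = 1" by (intro max_norm_eq_1[of _ _ m]) auto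
  then show ?thesis using assms(4) one by (simp add: radial_def)
qed

lemma side_dir_k: "side_dir m k z k = side_dir m k z m"
  by (simp add: side_dir_def)

lemma radial_side_dir_bounds:
  assumes "j \<le> m"
  shows "0 \<le> radial m (side_dir m k z) j" "radial m (side_dir m k z) j \<le> 1"
  using radial_side_dir[of z] assms by (auto simp: cube_boundary_iff topspace_cube)

text \<open>Slot k copies the last coordinate, so a face met in slot k is also met in slot
  m.\<close>

lemma radial_side_dir_face: "\<exists>j\<le>m. j \<noteq> k \<and> (radial m (side_dir m k z) j = 0 \<or> radial m (side_dir m k z) j = 1)"
proof -
  obtain j where "j \<le> m" "radial m (side_dir m k z) j = 0 \<or> radial m (side_dir m k z) j = 1"
    using radial_side_dir[of z] by (auto simp: cube_boundary_iff less_Suc_eq_le)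
  moreover have "radial m (side_dir m k z) k = radial m (side_dir m k z) m"
    using k side_dir_k by (simp add: radial_def)
  ultimately show ?thesis using k by (metis less_irrefl order_refl)
qed

text \<open>For r = 1 a coordinate other than k lies on a face, for t = 0 or 1 coordinate k does.
  The tooth t = 1/2 below the spine is left out, since it belongs to the membrane.\<close>

lemma model_in_cube_boundary:
  assumes "t \<in> {0..1}" "r \<in> {0..1}" "r = 1 \<or> t = 0 \<or> t = 1"
  shows "model m k (t, r) z \<in> cube_boundary (Suc m)"
proof -
  have "0 \<le> model m k (t, r) z j \<and> model m k (t, r) z j \<le> 1" if "j \<le> m" for j
  proof -
    let ?s = "radial m (side_dir m k z) j"
    have s: "0 \<le> ?s" "?s \<le> 1" using radial_side_dir_bounds that by auto
    have "0 \<le> r * (1 - ?s)" "r * (1 - ?s) \<le> 1" using s assms(2) by (auto intro!: mult_le_one)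
    then show ?thesis using that assms(1) by (auto simp: model_def algebra_simps)
  qed
  moreover have "\<exists>j\<le>m. model m k (t, r) z j = 0 \<or> model m k (t, r) z j = 1"
  proof (cases "r = 1")
    case True
    then show ?thesis using radial_side_dir_face[of z] by (auto simp: model_def)
  next
    case False
    then show ?thesis using assms(3) k by (intro exI[of _ k]) (auto simp: model_def)
  qed
  ultimately show ?thesis using k by (auto simp: cube_boundary_iff topspace_cube model_def less_Suc_eq_le)
qed

lemma continuous_on_turn: "continuous_on S (\<lambda>z. turn k z j)"
  unfolding turn_def by (cases "j = k"; cases "j = 0"; simp) (intro continuous_intros)+

lemma continuous_on_side_dir: "continuous_on S (side_dir m k)"
proof (rule continuous_on_coordinatewise_then_product)
  fix j
  have *: "continuous_on S (side_bump m k)"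
    unfolding side_bump_def by (intro continuous_intros continuous_on_turn)
  show "continuous_on S (\<lambda>z. side_dir m k z j)"
  proof (cases "j < m \<and> j \<noteq> k")
    case True
    then show ?thesis
      unfolding side_dir_def by simp (intro continuous_intros continuous_on_turn *)
  next
    case False
    then have "(\<lambda>z. side_dir m k z j) = (\<lambda>z. 1 - 2 * side_bump m k z)"
      by (auto simp: side_dir_def)
    then show ?thesis by (simp only:) (intro continuous_intros *)
  qed
qed

lemma continuous_on_radial_side_dir: "continuous_on S (\<lambda>z. radial m (side_dir m k z))"
  by (rule continuous_on_compose2[OF continuous_on_radial continuous_on_side_dir])
     (use side_dir_nonzero in blast)

lemma continuous_on_model:
  assumes "continuous_on S f" "continuous_on S g"
  shows "continuous_on S (\<lambda>x. model m k (f x) (g x))"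
proof (rule continuous_on_coordinatewise_then_product)
  fix j
  have "continuous_on S (\<lambda>x. radial m (side_dir m k (g x)) j)"
    by (rule continuous_on_product_then_coordinatewise)
       (rule continuous_on_compose2[OF continuous_on_radial_side_dir assms(2) subset_UNIV])
  then show "continuous_on S (\<lambda>x. model m k (f x) (g x) j)"
    unfolding model_def using assms(1)
    by (cases "j = k"; cases "j \<le> m") (simp_all, (intro continuous_intros; assumption)+)
qed

lemma model_edge: "j \<le> m \<Longrightarrow> j \<noteq> k \<Longrightarrow> model m k (t, 0) z j = 1"
  by (simp add: model_def)

lemma model_boundary:
  assumes "z \<in> cube_boundary m" "z 0 \<noteq> 0" "z 0 \<noteq> 1" "j \<le> m" "j \<noteq> k"
  shows "model m k tr z j = 1"
  using radial_side_dir_boundary[OF assms(1-4)] assms(4,5) by (simp add: model_def)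

lemma cube_coord_0: "z \<in> topspace (cube m) \<Longrightarrow> z 0 \<in> {0..1}"
  using k by (auto simp: topspace_cube)

lemma model_route_in: "z \<in> topspace (cube m) \<Longrightarrow> model m k (route (z 0)) z \<in> cube_boundary (Suc m)"
  unfolding route_def using route_in[of "z 0"] cube_coord_0 by (intro model_in_cube_boundary) auto

lemma continuous_on_model_route: "continuous_on S (\<lambda>z. model m k (route (z 0)) z)"
  unfolding route_def
  by (intro continuous_on_model continuous_on_Pair continuous_on_id
      continuous_on_compose2[OF continuous_on_route(1) continuous_on_coord subset_UNIV]
      continuous_on_compose2[OF continuous_on_route(2) continuous_on_coord subset_UNIV])

text \<open>There are two reasons: at the ends of the route r = 0, and on the remaining faces the
  side bump vanishes, so that the wall point already lies in the corner edge.\<close>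

lemma model_route_boundary:
  assumes "z \<in> cube_boundary m" "j \<le> m" "j \<noteq> k"
  shows "model m k (route (z 0)) z j = 1"
proof (cases "z 0 = 0 \<or> z 0 = 1")
  case True
  then show ?thesis using assms model_edge by (auto simp: route_def route_ends)
next
  case False
  then show ?thesis using assms model_boundary by blast
qed

section \<open>Deforming the parametrisation into the model\<close>

text \<open>The segment from the identity to a quarter turn acts on the plane of coordinates 0 and k
  with determinant (1 - t)^2 + t^2 > 0. So the moving direction could vanish only at the centre, but
  there its last coordinate is the height -1.\<close>

lemma sheared_turn_homotopic:
  assumes W: "continuous_map (top_of_set (cube_boundary (Suc m))) X W"
    and edge: "\<And>w. w \<in> cube_boundary (Suc m) \<Longrightarrow> (\<And>j. j \<le> m \<Longrightarrow> j \<noteq> k \<Longrightarrow> w j = 1) \<Longrightarrow> W w = x0"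
  shows "homotopic_with (\<lambda>h. \<forall>z\<in>cube_boundary m. h z = x0) (cube m) X
    (\<lambda>z. W (radial m (sheared m (\<lambda>i. 2 * z i - 1) z))) (\<lambda>z. W (radial m (sheared m (turn k z) z)))"
proof (rule radial_homotopic[OF W edge k])
  show "continuous_on (topspace (cube m)) (\<lambda>z. sheared m (\<lambda>i. 2 * z i - 1) z)"
    by (intro continuous_on_sheared continuous_intros)
  show "continuous_on (topspace (cube m)) (\<lambda>z. sheared m (turn k z) z)"
    by (intro continuous_on_sheared continuous_on_turn)
  fix z t assume z: "z \<in> topspace (cube m)" "z \<notin> cube_boundary m" and t: "0 \<le> t" "t \<le> (1::real)"
  show "\<exists>j\<le>m. (1 - t) * sheared m (\<lambda>i. 2 * z i - 1) z j + t * sheared m (turn k z) z j \<noteq> 0"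
  proof (rule ccontr)
    assume "\<not> ?thesis"
    then have zero: "(1 - t) * sheared m (\<lambda>i. 2 * z i - 1) z j + t * sheared m (turn k z) z j = 0"
      if "j \<le> m" for j using that by blast
    have h: "height m z = 0" using zero[of m] by (simp add: sheared_def algebra_simps)
    have "horiz m z \<noteq> 0" using z horiz_eq_0_iff by blast
    moreover have "horiz m z * ((1 - t) * (2 * z j - 1) + t * turn k z j) = 0" if "j < m" for j
      using zero[of j] that h by (simp add: sheared_def algebra_simps)
    ultimately have lin: "(1 - t) * (2 * z j - 1) + t * turn k z j = 0" if "j < m" for j using that by simp
    have "2 * z j - 1 = 0" if j: "j < m" for j
    proof (cases "j \<noteq> 0 \<and> j \<noteq> k \<or> k = 0")
      case True
      then show ?thesis using lin[OF j] by (auto simp: turn_def algebra_simps split: if_splits)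
    next
      case False
      then have k0: "k \<noteq> 0" by simp
      define a b where "a = 2 * z 0 - 1" and "b = 2 * z k - 1"
      have "(1 - t) * a = t * b" "(1 - t) * b = - (t * a)"
        using lin[of 0] lin[OF k] k k0 by (auto simp: turn_def a_def b_def algebra_simps)
      then have "((1 - t)\<^sup>2 + t\<^sup>2) * a = 0" "((1 - t)\<^sup>2 + t\<^sup>2) * b = 0"
        by algebra+
      moreover have "(1 - t)\<^sup>2 + t\<^sup>2 \<noteq> 0" by (simp add: sum_power2_eq_zero_iff)
      ultimately show ?thesis using False by (auto simp: a_def b_def)
    qed
    then have "height m z = - 1" by (rule height_centre)
    with h show False by simp
  qed
qed (auto simp: sheared_boundary)

text \<open>
  If the segment between the two directions passed through 0 at an interior point, comparing the
  coordinates $j \ne k$ with the last one would force the turned point onto the $k$-axis. There both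
  directions lie on the same side of the diagonal of the $(k,m)$-plane, and at the centre both are
  negative multiples of the diagonal.
\<close>

lemma sheared_model_homotopic:
  assumes W: "continuous_map (top_of_set (cube_boundary (Suc m))) X W"
    and edge: "\<And>w. w \<in> cube_boundary (Suc m) \<Longrightarrow> (\<And>j. j \<le> m \<Longrightarrow> j \<noteq> k \<Longrightarrow> w j = 1) \<Longrightarrow> W w = x0"
  shows "homotopic_with (\<lambda>h. \<forall>z\<in>cube_boundary m. h z = x0) (cube m) X
    (\<lambda>z. W (radial m (sheared m (turn k z) z)))
    (\<lambda>z. W (radial m (\<lambda>j. 2 * model m k (route (z 0)) z j - 1)))"
proof (rule radial_homotopic[OF W edge k])
  show "continuous_on (topspace (cube m)) (\<lambda>z. sheared m (turn k z) z)"
    by (intro continuous_on_sheared continuous_on_turn)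
  have "continuous_on (topspace (cube m)) (\<lambda>z. model m k (route (z 0)) z j)" for j
    by (rule continuous_on_product_then_coordinatewise[OF continuous_on_model_route])
  then show "continuous_on (topspace (cube m)) (\<lambda>z j. 2 * model m k (route (z 0)) z j - 1)"
    by (intro continuous_on_coordinatewise_then_product continuous_intros)
  show "\<bar>2 * model m k (route (z 0)) z j - 1\<bar> \<le> 1 \<and> (j \<noteq> k \<longrightarrow> 2 * model m k (route (z 0)) z j - 1 = 1)"
    if "z \<in> cube_boundary m" "j \<le> m" for z j
  proof -
    have "z \<in> topspace (cube m)" using that(1) by (simp add: cube_boundary_iff)
    from model_route_in[OF this] have "0 \<le> model m k (route (z 0)) z j" "model m k (route (z 0)) z j \<le> 1"
      using that(2) by (simp_all add: cube_boundary_iff topspace_cube less_Suc_eq_le)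
    then show ?thesis using model_route_boundary[OF that] by (simp add: abs_le_iff)
  qed
  fix z t assume z: "z \<in> topspace (cube m)" "z \<notin> cube_boundary m" and t: "0 \<le> t" "t \<le> (1::real)"
  let ?P = "sheared m (turn k z) z" and ?M = "model m k (route (z 0)) z"
  show "\<exists>j\<le>m. (1 - t) * ?P j + t * (2 * ?M j - 1) \<noteq> 0"
  proof (rule ccontr)
    assume "\<not> ?thesis"
    then have zero: "(1 - t) * ?P j + t * (2 * ?M j - 1) = 0" if "j \<le> m" for j using that by blast
    define s T R n a c B where defs: "s = z 0" "T = route_t (z 0)" "R = route_r (z 0)"
      "n = max_norm m (side_dir m k z)" "a = horiz m z" "c = height m z" "B = side_bump m k z"
    have s01: "0 < s" "s < 1"
      using z k unfolding defs by (force simp: topspace_cube cube_boundary_iff less_le)+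
    have a: "a > 0" using z horiz_nonneg horiz_eq_0_iff unfolding defs by (metis less_eq_real_def)
    have B: "B > 0" using z side_bump_pos unfolding defs by blast
    have n: "n > 0" using side_dir_nonzero[of z] max_norm_pos unfolding defs by blast
    have R: "0 \<le> R" using route_in[of "z 0"] cube_coord_0[OF z(1)] unfolding defs by auto
    have M: "2 * ?M j - 1 = 1 - R + R * side_dir m k z j / n" if "j \<le> m" "j \<noteq> k" for j
      using that unfolding defs by (simp add: model_def route_def radial_def field_simps)
    have Mk: "2 * ?M k - 1 = 2 * T - 1" unfolding defs by (simp add: model_def route_def)
    \<comment> \<open>At t = 1 the direction is that of a boundary point, which has a coordinate 1
      or -1.\<close>
    have t1: "t < 1"
    proof (rule ccontr)
      assume "\<not> t < 1"
      then have "?M j = 1/2" if "j \<le> m" for j using zero[OF that] t by simp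
      moreover obtain j where "j \<le> m" "?M j = 0 \<or> ?M j = 1"
        using model_route_in[OF z(1)] by (auto simp: cube_boundary_iff less_Suc_eq_le)
      ultimately show False by force
    qed
    \<comment> \<open>Slot j minus slot m leaves \<open>turn k z j\<close> times a positive
      factor.\<close>
    have tn0: "turn k z j = 0" if j: "j < m" "j \<noteq> k" for j
    proof -
      have "(1 - t) * (a * turn k z j + c) + t * (1 - R + R * (B * turn k z j + (1 - 2 * B)) / n) = 0"
        using zero[of j] M[of j] j unfolding defs by (simp add: sheared_def side_dir_def)
      moreover have "(1 - t) * c + t * (1 - R + R * (1 - 2 * B) / n) = 0"
        using zero[of m] M[of m] k unfolding defs by (simp add: sheared_def side_dir_def)
      ultimately have "((1 - t) * a + t * R * B / n) * turn k z j = 0"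
        by (simp add: algebra_simps add_divide_distrib diff_divide_distrib)
      moreover have "(1 - t) * a + t * R * B / n > 0"
        using t1 a t(1) R B n by (intro add_pos_nonneg) auto
      ultimately show ?thesis by simp
    qed
    have B1: "B = 1" unfolding defs side_bump_def using tn0 by (intro prod.neutral) auto
    then have sd: "side_dir m k z j = - 1" for j using tn0 unfolding defs by (simp add: side_dir_def)
    have n1: "n = 1" unfolding defs by (rule max_norm_eq_1[of _ _ m]) (auto simp: sd)
    have em: "(1 - t) * c + t * (1 - 2 * R) = 0"
      using zero[of m] M[of m] k sd n1 unfolding defs by (simp add: sheared_def)
    have ek: "(1 - t) * (a * (2 * s - 1) + c) + t * (2 * T - 1) = 0"
      using zero[of k] Mk k unfolding defs by (simp add: sheared_def turn_def)
    \<comment> \<open>Slot k minus slot m cancels \<open>c\<close>. The first remaining term has the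
      sign of s - 1/2 and, by the timing of the route, the second never has the opposite
      one.\<close>
    have dif: "(1 - t) * (a * (2 * s - 1)) + t * (2 * (T + R - 1)) = 0"
      using em ek by (simp add: algebra_simps)
    have "s = 1/2"
    proof (rule ccontr)
      assume "s \<noteq> 1/2"
      then consider "s < 1/2" | "s > 1/2" by linarith
      then show False
      proof cases
        case 1
        then have "T + R - 1 \<le> 0" using s01 unfolding defs by (auto simp: route_t_def route_r_def)
        then have "t * (2 * (T + R - 1)) \<le> 0" using t by (intro mult_nonneg_nonpos) auto
        moreover have "(1 - t) * (a * (2 * s - 1)) < 0" using t1 a 1 by (intro mult_pos_neg) auto
        ultimately show False using dif by linarith
      next
        case 2
        then have "T + R - 1 \<ge> 0" using s01 unfolding defs by (auto simp: route_t_def route_r_def min_def max_def)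
        then have "t * (2 * (T + R - 1)) \<ge> 0" using t by (intro mult_nonneg_nonneg) auto
        moreover have "(1 - t) * (a * (2 * s - 1)) > 0" using t1 a 2 by (intro mult_pos_pos) auto
        ultimately show False using dif by linarith
      qed
    qed
    then have R1: "R = 1" and tk: "turn k z k = 0" unfolding defs by (auto simp: route_r_def turn_def)
    have "2 * z j - 1 = 0" if j: "j < m" for j
    proof (cases "j = k")
      case True
      then show ?thesis using tn0[of 0] tk k by (cases "k = 0") (auto simp: turn_def)
    next
      case False
      then show ?thesis using tn0[OF j False] tk by (cases "j = 0") (auto simp: turn_def)
    qed
    then have "c = - 1" unfolding defs by (rule height_centre)
    \<comment> \<open>At the centre \<open>em\<close> reads -1 = 0.\<close>
    with em R1 show False by simp
  qed
qed (auto simp: sheared_boundary)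

lemma boundary_param_homotopic_model:
  assumes W: "continuous_map (top_of_set (cube_boundary (Suc m))) X W"
    and edge: "\<And>w. w \<in> cube_boundary (Suc m) \<Longrightarrow> (\<And>j. j \<le> m \<Longrightarrow> j \<noteq> k \<Longrightarrow> w j = 1) \<Longrightarrow> W w = x0"
  shows "homotopic_with (\<lambda>h. \<forall>z\<in>cube_boundary m. h z = x0) (cube m) X
    (W \<circ> boundary_param m) (\<lambda>z. W (model m k (route (z 0)) z))"
proof -
  let ?P = "\<lambda>h. \<forall>z\<in>cube_boundary m. h z = x0"
  have hom: "homotopic_with ?P (cube m) X (W \<circ> boundary_param m)
      (\<lambda>z. W (radial m (\<lambda>j. 2 * model m k (route (z 0)) z j - 1)))"
    unfolding comp_def boundary_param_eq
    by (rule homotopic_with_trans[OF sheared_turn_homotopic[OF W edge] sheared_model_homotopic[OF W edge]])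
  have "W (radial m (\<lambda>j. 2 * model m k (route (z 0)) z j - 1)) = W (model m k (route (z 0)) z)"
    if "z \<in> topspace (cube m)" for z
    using radial_rescale[OF model_route_in[OF that]] by simp
  then have "homotopic_with ?P (cube m) X (\<lambda>z. W (radial m (\<lambda>j. 2 * model m k (route (z 0)) z j - 1)))
      (\<lambda>z. W (model m k (route (z 0)) z))"
    using homotopic_with_imp_continuous_maps[OF hom] homotopic_with_imp_property[OF hom]
    by (intro homotopic_with_equal) (auto simp: cube_boundary_iff)
  then show ?thesis using homotopic_with_trans[OF hom] by blast
qed

end

section \<open>Pasting and substitution of continuous maps\<close>

lemma continuous_map_if_le:
  assumes "continuous_on S p" "continuous_on S q"
    and "continuous_map (top_of_set {x\<in>S. p x \<le> q x}) X f"
    and "continuous_map (top_of_set {x\<in>S. q x \<le> p x}) X g"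
    and "\<And>x. x \<in> S \<Longrightarrow> p x = q x \<Longrightarrow> f x = g x"
  shows "continuous_map (top_of_set S) X (\<lambda>x. if p x \<le> (q x :: real) then f x else g x)"
proof -
  have "S \<inter> {x \<in> S. p x \<le> q x} = {x \<in> S. p x \<le> q x}" "S \<inter> {x \<in> S. q x \<le> p x} = {x \<in> S. q x \<le> p x}"
    by auto
  then show ?thesis
    using assms by (intro continuous_map_cases_le) (auto simp: subtopology_subtopology)
qed

lemma continuous_map_compose_on:
  assumes "continuous_map (top_of_set T) X f" "continuous_on S g" "g ` S \<subseteq> T"
  shows "continuous_map (top_of_set S) X (\<lambda>x. f (g x))"
  using continuous_map_compose[of "top_of_set S" "top_of_set T" g X f] assms
  by (auto simp: comp_def)

lemma continuous_on_fun_upd: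
  fixes f :: "'b::topological_space \<Rightarrow> nat \<Rightarrow> real"
  assumes "continuous_on S f" "continuous_on S c"
  shows "continuous_on S (\<lambda>x. (f x)(i := c x))"
proof (rule continuous_on_coordinatewise_then_product)
  fix j
  show "continuous_on S (\<lambda>x. ((f x)(i := c x)) j)"
    using assms continuous_on_product_then_coordinatewise[OF assms(1), of j] by (cases "j = i") auto
qed

lemma continuous_on_snd_coord: "continuous_on S (\<lambda>y::'b::topological_space \<times> (nat \<Rightarrow> real). snd y i)"
  by (rule continuous_on_product_then_coordinatewise) (intro continuous_intros)

section \<open>Cutting the boundary of the cube along a membrane\<close>

lemma first_half_in_cube: "z \<in> topspace (cube m) \<Longrightarrow> z 0 \<le> 1/2 \<Longrightarrow> z(0 := 2 * z 0) \<in> topspace (cube m)"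
  by (auto simp: topspace_cube)

lemma second_half_in_cube: "z \<in> topspace (cube m) \<Longrightarrow> 1/2 \<le> z 0 \<Longrightarrow> m \<ge> 1 \<Longrightarrow> z(0 := 2 * z 0 - 1) \<in> topspace (cube m)"
  by (auto simp: topspace_cube)

lemma half_in_cube_boundary:
  assumes "z \<in> cube_boundary m"
  shows "z 0 \<le> 1/2 \<Longrightarrow> z(0 := 2 * z 0) \<in> cube_boundary m"
    and "1/2 \<le> z 0 \<Longrightarrow> z(0 := 2 * z 0 - 1) \<in> cube_boundary m"
proof -
  obtain i where i: "i < m" "z i = 0 \<or> z i = 1" and z: "z \<in> topspace (cube m)"
    using assms by (auto simp: cube_boundary_iff)
  show "z(0 := 2 * z 0) \<in> cube_boundary m" if "z 0 \<le> 1/2"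
    using first_half_in_cube[OF z that] i that
    by (cases "i = 0") (auto simp: cube_boundary_iff intro!: exI[of _ i])
  show "z(0 := 2 * z 0 - 1) \<in> cube_boundary m" if "1/2 \<le> z 0"
    using second_half_in_cube[OF z that] i that
    by (cases "i = 0") (auto simp: cube_boundary_iff intro!: exI[of _ i])
qed

lemma homotopic_loop_add:
  assumes m: "m \<ge> 1"
    and F: "homotopic_with (\<lambda>h. \<forall>z\<in>cube_boundary m. h z = x0) (cube m) X F F'"
    and G: "homotopic_with (\<lambda>h. \<forall>z\<in>cube_boundary m. h z = x0) (cube m) X G G'"
  shows "homotopic_with (\<lambda>h. \<forall>z\<in>cube_boundary m. h z = x0) (cube m) X (loop_add F G) (loop_add F' G')"
proof -
  let ?C = "topspace (cube m)"
  have eqI: "prod_topology (top_of_set {0..1::real}) (cube m) = top_of_set ({0..1} \<times> ?C)"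
    by (subst cube_eq_top_of_set) simp
  obtain h where h: "continuous_map (top_of_set ({0..1::real} \<times> ?C)) X h"
    "\<forall>z. h (0, z) = F z" "\<forall>z. h (1, z) = F' z"
    "\<forall>t\<in>{0..1}. \<forall>z\<in>cube_boundary m. h (t, z) = x0"
    using F unfolding homotopic_with_def eqI by blast
  obtain h' where h': "continuous_map (top_of_set ({0..1::real} \<times> ?C)) X h'"
    "\<forall>z. h' (0, z) = G z" "\<forall>z. h' (1, z) = G' z"
    "\<forall>t\<in>{0..1}. \<forall>z\<in>cube_boundary m. h' (t, z) = x0"
    using G unfolding homotopic_with_def eqI by blast
  let ?K = "\<lambda>y. if snd y 0 \<le> 1/2 then h (fst y, (snd y)(0 := 2 * snd y 0))
      else h' (fst y, (snd y)(0 := 2 * snd y 0 - 1))"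
  have "continuous_map (top_of_set ({0..1} \<times> ?C)) X ?K"
  proof (rule continuous_map_if_le)
    show "continuous_map (top_of_set {y \<in> {0..1} \<times> ?C. snd y 0 \<le> 1/2}) X
        (\<lambda>y. h (fst y, (snd y)(0 := 2 * snd y 0)))"
      by (rule continuous_map_compose_on[OF h(1)])
         (auto intro!: continuous_on_Pair continuous_on_fst continuous_on_snd continuous_on_id
            continuous_on_fun_upd continuous_on_mult continuous_on_const continuous_on_snd_coord first_half_in_cube)
    show "continuous_map (top_of_set {y \<in> {0..1} \<times> ?C. 1/2 \<le> snd y 0}) X
        (\<lambda>y. h' (fst y, (snd y)(0 := 2 * snd y 0 - 1)))"
      by (rule continuous_map_compose_on[OF h'(1)])
         (use m in \<open>auto intro!: continuous_on_Pair continuous_on_fst continuous_on_snd continuous_on_id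
            continuous_on_fun_upd continuous_on_mult continuous_on_diff continuous_on_const continuous_on_snd_coord second_half_in_cube\<close>)
    show "h (fst y, (snd y)(0 := 2 * snd y 0)) = h' (fst y, (snd y)(0 := 2 * snd y 0 - 1))"
      if y: "y \<in> {0..1} \<times> ?C" and eq: "snd y 0 = 1/2" for y
    proof -
      have "(snd y)(0 := 1) \<in> cube_boundary m" "(snd y)(0 := 0) \<in> cube_boundary m"
        using y m by (auto simp: cube_boundary_iff topspace_cube intro!: exI[of _ 0])
      then have "h (fst y, (snd y)(0 := 1)) = x0" "h' (fst y, (snd y)(0 := 0)) = x0"
        using h(4) h'(4) y by auto
      moreover have "2 * snd y 0 = 1" "2 * snd y 0 - 1 = 0" using eq by simp_all
      ultimately show ?thesis by simp
    qed
  qed (intro continuous_on_snd_coord continuous_on_const)+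
  then show ?thesis
    unfolding homotopic_with_def eqI loop_add_def
    using h(2-4) h'(2-4) half_in_cube_boundary
    by (intro exI[of _ ?K]) (auto simp: half_in_cube_boundary)
qed

text \<open>Slots of \<open>turn\<close> other than k do not see z 0. So rescaling z 0, as
  \<open>loop_add\<close> does, affects only the point of the comb.\<close>

lemma model_fun_upd_0: "model m k tr (z(0 := c)) = model m k tr z"
proof -
  have "turn k (z(0 := c)) j = turn k z j" if "j \<noteq> k" for j
    using that by (auto simp: turn_def)
  then have "side_dir m k (z(0 := c)) = side_dir m k z"
    by (simp add: side_dir_def side_bump_def fun_eq_iff)
  then show ?thesis by (simp add: model_def cong: if_cong)
qed

lemma model_fun_upd_k: "(model m k (t, r) z)(k := t') = model m k (t', r) z"
  by (auto simp: model_def)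

text \<open>\<open>W1\<close> and \<open>W2\<close> live on the boundaries of the two half boxes,
  each stretched along axis k to a full cube; \<open>glue\<close> is their agreement on the
  membrane. Together they give one map \<open>A\<close> on comb times cube, and up to homotopy both
  sides are \<open>A\<close> along one of the two paths in the comb.\<close>

proposition boundary_split_homotopic:
  assumes k: "k < m"
    and W: "continuous_map (top_of_set (cube_boundary (Suc m))) X W"
    and W1: "continuous_map (top_of_set (cube_boundary (Suc m))) X W1"
    and W2: "continuous_map (top_of_set (cube_boundary (Suc m))) X W2"
    and edge1: "\<And>w. w \<in> cube_boundary (Suc m) \<Longrightarrow> (\<And>j. j \<le> m \<Longrightarrow> j \<noteq> k \<Longrightarrow> w j = 1) \<Longrightarrow> W1 w = x0"
    and edge2: "\<And>w. w \<in> cube_boundary (Suc m) \<Longrightarrow> (\<And>j. j \<le> m \<Longrightarrow> j \<noteq> k \<Longrightarrow> w j = 1) \<Longrightarrow> W2 w = x0"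
    and split: "\<And>w. w \<in> cube_boundary (Suc m) \<Longrightarrow>
      W w = (if w k \<le> 1/2 then W1 (w(k := 2 * w k)) else W2 (w(k := 2 * w k - 1)))"
    and glue: "\<And>w. w \<in> cube_boundary (Suc m) \<Longrightarrow> w k = 1 \<Longrightarrow> W1 w = W2 (w(k := 0))"
  shows "homotopic_with (\<lambda>h. \<forall>z\<in>cube_boundary m. h z = x0) (cube m) X
    (W \<circ> boundary_param m) (loop_add (W1 \<circ> boundary_param m) (W2 \<circ> boundary_param m))"
proof -
  let ?C = "topspace (cube m)" and ?P = "\<lambda>h. \<forall>z\<in>cube_boundary m. h z = x0"
  let ?M = "\<lambda>V z. V (model m k (route (z 0)) z)"
  have m: "m \<ge> 1" using k by simp
  have edge: "W w = x0" if w: "w \<in> cube_boundary (Suc m)" "\<And>j. j \<le> m \<Longrightarrow> j \<noteq> k \<Longrightarrow> w j = 1" for w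
  proof -
    have upd: "w(k := c) \<in> cube_boundary (Suc m)" if "0 \<le> c" "c \<le> 1" for c
      using w k that by (auto simp: cube_boundary_iff topspace_cube intro!: exI[of _ m])
    have "0 \<le> w k" "w k \<le> 1" using w(1) k by (auto simp: cube_boundary_iff topspace_cube)
    then show ?thesis
      using split[OF w(1)] edge1[OF upd[of "2 * w k"]] edge2[OF upd[of "2 * w k - 1"]] w(2) by auto
  qed
  define A where "A = (\<lambda>((t, r), z). if t \<le> 1/2 then W1 (model m k (2 * t, r) z) else W2 (model m k (2 * t - 1, r) z))"
  have in1: "model m k (2 * t, r) z \<in> cube_boundary (Suc m)" if "(t, r) \<in> comb" "t \<le> 1/2" for t r z
    by (rule model_in_cube_boundary[OF k]) (use that in \<open>auto simp: comb_def\<close>)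
  have in2: "model m k (2 * t - 1, r) z \<in> cube_boundary (Suc m)" if "(t, r) \<in> comb" "1/2 \<le> t" for t r z
    by (rule model_in_cube_boundary[OF k]) (use that in \<open>auto simp: comb_def\<close>)
  have agree: "W1 (model m k (1, r) z) = W2 (model m k (0, r) z)" if "(1/2, r) \<in> comb" for r z
    using glue[OF in1[OF that]] by (simp add: model_fun_upd_k) (simp add: model_def)
  have A1: "A ((t, r), z) = W1 (model m k (2 * t, r) z)" if "t \<le> 1/2" for t r z
    using that by (simp add: A_def)
  have A2: "A ((t, r), z) = W2 (model m k (2 * t - 1, r) z)" if "(t, r) \<in> comb" "1/2 \<le> t" for t r z
  \<comment> \<open>On the tooth t = 1/2 \<open>A\<close> is defined through \<open>W1\<close>,
    whereas the second run of the route needs \<open>W2\<close> there.\<close>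
  proof (cases "t = 1/2")
    case True
    then show ?thesis using agree[of r z] that unfolding True by (simp add: A_def)
  next
    case False
    then show ?thesis using that by (simp add: A_def)
  qed
  have cm: "continuous_on S (\<lambda>y. model m k (2 * fst (fst y), snd (fst y)) (snd y))"
    "continuous_on S (\<lambda>y. model m k (2 * fst (fst y) - 1, snd (fst y)) (snd y))"
    for S :: "((real \<times> real) \<times> (nat \<Rightarrow> real)) set"
    by (rule continuous_on_model[OF k]; intro continuous_on_Pair continuous_on_diff continuous_on_mult
        continuous_on_const continuous_on_fst continuous_on_snd continuous_on_id)+
  have contA: "continuous_map (top_of_set (comb \<times> ?C)) X A"
  proof -
    have "continuous_map (top_of_set (comb \<times> ?C)) X (\<lambda>y. if fst (fst y) \<le> 1/2
        then W1 (model m k (2 * fst (fst y), snd (fst y)) (snd y))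
        else W2 (model m k (2 * fst (fst y) - 1, snd (fst y)) (snd y)))"
    proof (rule continuous_map_if_le)
      show "continuous_map (top_of_set {y \<in> comb \<times> ?C. fst (fst y) \<le> 1/2}) X
          (\<lambda>y. W1 (model m k (2 * fst (fst y), snd (fst y)) (snd y)))"
        by (rule continuous_map_compose_on[OF W1])
           (use in1 cm in auto)
      show "continuous_map (top_of_set {y \<in> comb \<times> ?C. 1/2 \<le> fst (fst y)}) X
          (\<lambda>y. W2 (model m k (2 * fst (fst y) - 1, snd (fst y)) (snd y)))"
        by (rule continuous_map_compose_on[OF W2])
           (use in2 cm in auto)
      show "W1 (model m k (2 * fst (fst y), snd (fst y)) (snd y)) =
          W2 (model m k (2 * fst (fst y) - 1, snd (fst y)) (snd y))"
        if "y \<in> comb \<times> ?C" and eq: "fst (fst y) = 1/2" for y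
      proof -
        have "(1/2, snd (fst y)) \<in> comb" using that by (metis mem_Times_iff prod.collapse)
        then show ?thesis using agree unfolding eq by simp
      qed
    qed (intro continuous_on_fst continuous_on_id continuous_on_const)+
    moreover have "A = (\<lambda>y. if fst (fst y) \<le> 1/2
        then W1 (model m k (2 * fst (fst y), snd (fst y)) (snd y))
        else W2 (model m k (2 * fst (fst y) - 1, snd (fst y)) (snd y)))"
      by (auto simp: A_def)
    ultimately show ?thesis by simp
  qed
  let ?q = "(\<lambda>s. (route_t s / 2, route_r s)) +++ (\<lambda>s. ((1 + route_t s) / 2, route_r s))"
  obtain \<eta> where \<eta>c: "continuous_on ({0..1::real} \<times> {0..1::real}) \<eta>"
    and \<eta>i: "\<eta> \<in> {0..1} \<times> {0..1} \<rightarrow> comb"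
    and \<eta>0: "\<forall>s\<in>{0..1}. \<eta> (0, s) = (route_t s, route_r s)"
    and \<eta>1: "\<forall>s\<in>{0..1}. \<eta> (1, s) = ?q s"
    and ends: "\<forall>l\<in>{0..1}. pathstart (\<eta> \<circ> Pair l) = pathstart (\<lambda>s. (route_t s, route_r s)) \<and>
      pathfinish (\<eta> \<circ> Pair l) = pathfinish (\<lambda>s. (route_t s, route_r s))"
    using route_homotopic unfolding homotopic_paths by blast
  have \<eta>e: "\<eta> (l, 0) = (0, 0)" "\<eta> (l, 1) = (1, 0)" if "l \<in> {0..1}" for l
    using bspec[OF ends that] by (simp_all add: pathstart_def pathfinish_def route_ends)
  \<comment> \<open>Time moves the path in the comb, z 0 is the position on it, and the other
    coordinates of z choose the wall point.\<close>
  let ?K = "\<lambda>y. A (\<eta> (fst y, snd y 0), snd y)"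
  have z0: "z 0 \<in> {0..1}" if "z \<in> ?C" for z using cube_coord_0[OF k that] .
  have "continuous_map (top_of_set ({0..1} \<times> ?C)) X ?K"
  proof (rule continuous_map_compose_on[OF contA])
    have "continuous_on ({0..1} \<times> ?C) (\<lambda>y::real \<times> (nat \<Rightarrow> real). \<eta> (fst y, snd y 0))"
      by (rule continuous_on_compose2[OF \<eta>c])
         (use z0 in \<open>auto intro!: continuous_on_Pair continuous_on_fst continuous_on_id continuous_on_snd_coord\<close>)
    then show "continuous_on ({0..1} \<times> ?C) (\<lambda>y. (\<eta> (fst y, snd y 0), snd y))"
      by (intro continuous_on_Pair continuous_on_snd continuous_on_id)
    show "(\<lambda>y. (\<eta> (fst y, snd y 0), snd y)) ` ({0..1} \<times> ?C) \<subseteq> comb \<times> ?C"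
      using \<eta>i z0 by (auto simp: Pi_iff)
  qed
  then have contK: "continuous_map (prod_topology (top_of_set {0..1}) (cube m)) X ?K"
    by (subst cube_eq_top_of_set) simp
  have K0: "?K (0, z) = ?M W z" if z: "z \<in> ?C" for z
  proof -
    have "?M W z = A (route (z 0), z)"
      using split[OF model_route_in[OF k z]]
      by (simp add: route_def model_fun_upd_k A_def) (simp add: model_def)
    then show ?thesis using bspec[OF \<eta>0 z0[OF z]] by (simp add: route_def)
  qed
  have K1: "?K (1, z) = loop_add (?M W1) (?M W2) z" if z: "z \<in> ?C" for z
  proof (cases "z 0 \<le> 1/2")
    case True
    have "2 * z 0 \<in> {0..1}" using True z0[OF z] by auto
    then have "route_t (2 * z 0) / 2 \<le> 1/2" using route_in(1)[of "2 * z 0"] by simp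
    then show ?thesis
      using True bspec[OF \<eta>1 z0[OF z]] by (simp add: joinpaths_def loop_add_def A1 route_def model_fun_upd_0)
  next
    case False
    have "2 * z 0 - 1 \<in> {0..1}" using False z0[OF z] by auto
    then have r: "1/2 \<le> (1 + route_t (2 * z 0 - 1)) / 2" using route_in(1)[of "2 * z 0 - 1"] by simp
    have "\<eta> (1, z 0) \<in> comb" using \<eta>i z0[OF z] by (auto simp: Pi_iff)
    moreover have "\<eta> (1, z 0) = ((1 + route_t (2 * z 0 - 1)) / 2, route_r (2 * z 0 - 1))"
      using False bspec[OF \<eta>1 z0[OF z]] by (simp add: joinpaths_def)
    moreover have "(2 + 2 * x) / 2 - 1 = x" for x :: real by (simp add: field_simps)
    ultimately show ?thesis
      using False A2[OF _ r] by (simp add: loop_add_def route_def model_fun_upd_0)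
  qed
  have Kb: "?K (l, z) = x0" if l: "l \<in> {0..1}" and z: "z \<in> cube_boundary m" for l z
  proof -
    obtain t r where tr: "\<eta> (l, z 0) = (t, r)" by fastforce
    have zC: "z \<in> ?C" using z by (simp add: cube_boundary_iff)
    have "\<eta> (l, z 0) \<in> comb" using \<eta>i l z0[OF zC] by (auto simp: Pi_iff)
    then have c: "(t, r) \<in> comb" by (simp add: tr)
    \<comment> \<open>All paths of the homotopy share their ends, where r = 0; on the other faces
      the point of the comb matters only in slot k.\<close>
    have one: "model m k (t', r) z j = 1" if "j \<le> m" "j \<noteq> k" for t' j
    proof (cases "z 0 = 0 \<or> z 0 = 1")
      case True
      then have "r = 0" using \<eta>e[OF l] tr by auto
      then show ?thesis using that model_edge[OF k] by blast
    next
      case False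
      then show ?thesis using that z model_boundary[OF k z] by blast
    qed
    show ?thesis
    proof (cases "t \<le> 1/2")
      case True
      then show ?thesis using edge1[OF in1[OF c True] one] by (simp add: tr A1)
    next
      case False
      then have "1/2 \<le> t" by simp
      then show ?thesis using edge2[OF in2[OF c] one] A2[OF c] by (simp add: tr)
    qed
  qed
  have "homotopic_with ?P (cube m) X (?M W) (loop_add (?M W1) (?M W2))"
    using contK K0 K1 Kb by (subst homotopic_with) (auto simp: cube_boundary_iff intro!: exI[of _ ?K])
  moreover have "homotopic_with ?P (cube m) X (W \<circ> boundary_param m) (?M W)"
    by (rule boundary_param_homotopic_model[OF k W edge])
  moreover have "homotopic_with ?P (cube m) X (loop_add (?M W1) (?M W2))
      (loop_add (W1 \<circ> boundary_param m) (W2 \<circ> boundary_param m))"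
    by (intro homotopic_loop_add m homotopic_with_symD[OF boundary_param_homotopic_model[OF k W1 edge1]]
        homotopic_with_symD[OF boundary_param_homotopic_model[OF k W2 edge2]])
  ultimately show ?thesis by (meson homotopic_with_trans)
qed

section \<open>Whitehead products\<close>

text \<open>This is W_{f,g} of the overview. The test is on the second component, as in
  \<open>wedge_map\<close>; where both components are boundary points, loops give the base point in
  either branch.\<close>

definition boundary_glue ::
    "nat \<Rightarrow> nat \<Rightarrow> ((nat \<Rightarrow> real) \<Rightarrow> 'a) \<Rightarrow> ((nat \<Rightarrow> real) \<Rightarrow> 'a) \<Rightarrow> (nat \<Rightarrow> real) \<Rightarrow> 'a" where
  "boundary_glue p q f g w =
    (if snd (cube_split p q w) \<in> cube_boundary q then f (fst (cube_split p q w)) else g (snd (cube_split p q w)))"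

lemma sheared_nonzero:
  assumes "z \<in> topspace (cube m)"
  shows "\<exists>j\<le>m. sheared m (\<lambda>i. 2 * z i - 1) z j \<noteq> 0"
proof (rule ccontr)
  assume "\<not> ?thesis"
  then have zero: "sheared m (\<lambda>i. 2 * z i - 1) z j = 0" if "j \<le> m" for j using that by blast
  have h: "height m z = 0" using zero[of m] by (simp add: sheared_def)
  then have "horiz m z \<noteq> 0" using assms horiz_eq_0_iff height_boundary by fastforce
  then have "2 * z j - 1 = 0" if "j < m" for j
    using zero[of j] that h by (simp add: sheared_def)
  then have "height m z = - 1" by (rule height_centre)
  with h show False by simp
qed

lemma boundary_param_in_cube_boundary:
  "z \<in> topspace (cube m) \<Longrightarrow> boundary_param m z \<in> cube_boundary (Suc m)"
  unfolding boundary_param_eq using sheared_nonzero radial_in_cube_boundary by blast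

text \<open>Needed for the image condition: the Whitehead product then attains every value of both
  loops. A preimage is found by undoing the shear, normalising to the unit sphere and lifting to the
  cube; radial projection does not see the factor 1/s.\<close>

lemma boundary_param_surj:
  assumes m: "m \<ge> 1"
  shows "boundary_param m ` topspace (cube m) = cube_boundary (Suc m)"
proof (intro equalityI subsetI)
  fix c assume c: "c \<in> cube_boundary (Suc m)"
  define w where "w i = 2 * c i - 1" for i
  define y where "y i = (if i < m then w i - w m else if i = m then w m else 0)" for i
  define s where "s = sqrt (\<Sum>i\<le>m. (y i)\<^sup>2)"
  obtain j where j: "j \<le> m" "w j \<noteq> 0"
    using c by (force simp: w_def cube_boundary_iff less_Suc_eq_le)
  have "\<exists>i\<le>m. y i \<noteq> 0"
  proof (rule ccontr)
    assume "\<not> ?thesis"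
    then have z: "y i = 0" if "i \<le> m" for i using that by blast
    have "w m = 0" using z[of m] by (simp add: y_def)
    then show False using z[OF j(1)] j by (auto simp: y_def split: if_splits)
  qed
  then obtain i where i: "i \<le> m" "y i \<noteq> 0" by blast
  have "0 < (\<Sum>i\<le>m. (y i)\<^sup>2)" by (rule sum_pos2[of _ i]) (use i in auto)
  then have s: "s > 0" and s2: "s\<^sup>2 = (\<Sum>i\<le>m. (y i)\<^sup>2)" by (auto simp: s_def)
  have "(\<lambda>i. y i / s) \<in> topspace (nsphere m)"
    using s by (auto simp: topspace_nsphere y_def power_divide simp flip: sum_divide_distrib)
       (simp add: s2 y_def)
  then obtain z where z: "z \<in> topspace (cube m)" "cube_to_sphere m z = (\<lambda>i. y i / s)"
    using cube_to_sphere_surj[OF m] by (metis imageE)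
  have sh: "sheared m (\<lambda>i. 2 * z i - 1) z i = w i / s" if "i \<le> m" for i
  proof -
    have "height m z = w m / s" using fun_cong[OF z(2), of m] by (simp add: cube_to_sphere_eq y_def)
    moreover have "horiz m z * (2 * z i - 1) = (w i - w m) / s" if "i < m"
      using fun_cong[OF z(2), of i] that by (simp add: cube_to_sphere_eq y_def)
    ultimately show ?thesis using that by (cases "i < m") (auto simp: sheared_def diff_divide_distrib)
  qed
  have "max_norm m (sheared m (\<lambda>i. 2 * z i - 1) z) = max_norm m w / s"
  proof (rule antisym)
    show "max_norm m (sheared m (\<lambda>i. 2 * z i - 1) z) \<le> max_norm m w / s"
      using max_norm_attained[of m "sheared m (\<lambda>i. 2 * z i - 1) z"] sh s abs_le_max_norm[of _ m w]
      by (metis abs_divide abs_of_pos divide_right_mono less_imp_le)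
    show "max_norm m w / s \<le> max_norm m (sheared m (\<lambda>i. 2 * z i - 1) z)"
      using max_norm_attained[of m w] sh s abs_le_max_norm[of _ m "sheared m (\<lambda>i. 2 * z i - 1) z"]
      by (metis abs_divide abs_of_pos)
  qed
  then have "boundary_param m z = radial m w"
    unfolding boundary_param_eq radial_def using sh s by (auto simp: fun_eq_iff)
  also have "\<dots> = c" using radial_rescale[OF c] by (simp add: w_def[abs_def])
  finally show "c \<in> boundary_param m ` topspace (cube m)" using z(1) by blast
qed (use boundary_param_in_cube_boundary in blast)

lemma cube_split_in:
  assumes "w \<in> cube_boundary (p + q)"
  shows "fst (cube_split p q w) \<in> topspace (cube p)" "snd (cube_split p q w) \<in> topspace (cube q)"
    "fst (cube_split p q w) \<in> cube_boundary p \<or> snd (cube_split p q w) \<in> cube_boundary q"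
proof -
  have w: "\<And>i. i < p + q \<Longrightarrow> 0 \<le> w i \<and> w i \<le> 1" using assms by (auto simp: cube_boundary_iff topspace_cube)
  show 1: "fst (cube_split p q w) \<in> topspace (cube p)" "snd (cube_split p q w) \<in> topspace (cube q)"
    using w by (auto simp: cube_split_def topspace_cube)
  obtain i where i: "i < p + q" "w i = 0 \<or> w i = 1" using assms by (auto simp: cube_boundary_iff)
  show "fst (cube_split p q w) \<in> cube_boundary p \<or> snd (cube_split p q w) \<in> cube_boundary q"
  proof (cases "i < p")
    case True
    then show ?thesis using i 1 by (auto simp: cube_boundary_iff cube_split_def)
  next
    case False
    then have "i - p < q" "w (p + (i - p)) = 0 \<or> w (p + (i - p)) = 1" using i by auto
    then have "snd (cube_split p q w) \<in> cube_boundary q"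
      using 1(2) by (auto simp: cube_boundary_iff cube_split_def intro!: exI[of _ "i - p"])
    then show ?thesis ..
  qed
qed

lemma loop_spaceD:
  assumes "f \<in> loop_space m X x0"
  shows "continuous_map (top_of_set (topspace (cube m))) X f" "\<And>z. z \<in> cube_boundary m \<Longrightarrow> f z = x0"
  using assms cube_eq_top_of_set[of m] by (auto simp: loop_space_def)

text \<open>The inverses in \<open>to_sphere\<close> cancel because loops are constant on the
  boundary, and the base point test of \<open>wedge_map\<close> becomes the test for the boundary of
  the second cube.\<close>

lemma whitehead_eq_boundary_glue:
  assumes m: "Suc m = p + q" and z: "z \<in> topspace (cube m)"
    and f: "f \<in> loop_space p X x0" and g: "g \<in> loop_space q X x0"
  shows "whitehead p q f g z = boundary_glue p q f g (boundary_param m z)"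
proof -
  define w where "w = boundary_param m z"
  have w: "w \<in> cube_boundary (p + q)" using boundary_param_in_cube_boundary[OF z] m by (simp add: w_def)
  have pq: "p + q - 1 = m" using m by simp
  have "whitehead p q f g z = wedge_map (sphere_base q) (to_sphere p f) (to_sphere q g)
      (cube_to_sphere p (fst (cube_split p q w)), cube_to_sphere q (snd (cube_split p q w)))"
    unfolding whitehead_def from_sphere_def attaching_map_def pq w_def boundary_param_def
    by (simp add: map_prod_def split_def)
  moreover have "to_sphere p f (cube_to_sphere p (fst (cube_split p q w))) = f (fst (cube_split p q w))"
    unfolding to_sphere_def using cube_split_in(1)[OF w] loop_spaceD(2)[OF f] by (rule inv_cube_to_sphere)
  moreover have "to_sphere q g (cube_to_sphere q (snd (cube_split p q w))) = g (snd (cube_split p q w))"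
    unfolding to_sphere_def using cube_split_in(2)[OF w] loop_spaceD(2)[OF g] by (rule inv_cube_to_sphere)
  ultimately show ?thesis
    using cube_to_sphere_eq_base_iff[OF cube_split_in(2)[OF w]]
    by (simp add: wedge_map_def boundary_glue_def flip: w_def)
qed

text \<open>
  On $\partial I^{p+q}$ one of the two bumps vanishes, so comparing them selects the right branch and
  makes both branches closed conditions.
\<close>

lemma continuous_map_boundary_glue:
  assumes f: "f \<in> loop_space p X x0" and g: "g \<in> loop_space q X x0"
  shows "continuous_map (top_of_set (cube_boundary (p + q))) X (boundary_glue p q f g)"
proof -
  let ?u = "\<lambda>w. fst (cube_split p q w)" and ?v = "\<lambda>w. snd (cube_split p q w)"
  let ?S = "cube_boundary (p + q)"
  have cu: "continuous_on S ?u" for S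
  proof (rule continuous_on_coordinatewise_then_product)
    show "continuous_on S (\<lambda>w. ?u w i)" for i
      unfolding cube_split_def by (cases "i < p") (simp_all add: continuous_on_coord)
  qed
  have cv: "continuous_on S ?v" for S
  proof (rule continuous_on_coordinatewise_then_product)
    show "continuous_on S (\<lambda>w. ?v w i)" for i
      unfolding cube_split_def by (cases "i < q") (simp_all add: continuous_on_coord)
  qed
  have bump0: "bump p (?u w) = 0 \<longleftrightarrow> ?u w \<in> cube_boundary p" "bump q (?v w) = 0 \<longleftrightarrow> ?v w \<in> cube_boundary q"
    "bump p (?u w) \<ge> 0" "bump q (?v w) \<ge> 0" if "w \<in> ?S" for w
    using cube_split_in[OF that] by (simp_all add: bump_eq_0_iff bump_nonneg)
  have "continuous_map (top_of_set ?S) X (\<lambda>w. if bump q (?v w) \<le> bump p (?u w) then f (?u w) else g (?v w))"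
  proof (rule continuous_map_if_le)
    show "continuous_on ?S (\<lambda>w. bump q (?v w))"
      by (rule continuous_on_compose2[OF continuous_on_bump cv subset_UNIV])
    show "continuous_on ?S (\<lambda>w. bump p (?u w))"
      by (rule continuous_on_compose2[OF continuous_on_bump cu subset_UNIV])
    show "continuous_map (top_of_set {w \<in> ?S. bump q (?v w) \<le> bump p (?u w)}) X (\<lambda>w. f (?u w))"
      by (rule continuous_map_compose_on[OF loop_spaceD(1)[OF f] cu]) (use cube_split_in in auto)
    show "continuous_map (top_of_set {w \<in> ?S. bump p (?u w) \<le> bump q (?v w)}) X (\<lambda>w. g (?v w))"
      by (rule continuous_map_compose_on[OF loop_spaceD(1)[OF g] cv]) (use cube_split_in in auto)
    show "f (?u w) = g (?v w)" if "w \<in> ?S" "bump q (?v w) = bump p (?u w)" for w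
      using bump0[OF that(1)] cube_split_in(3)[OF that(1)] that(2) loop_spaceD(2)[OF f] loop_spaceD(2)[OF g] by metis
  qed
  then show ?thesis
  proof (rule continuous_map_eq)
    fix w assume "w \<in> topspace (top_of_set ?S)"
    then have w: "w \<in> ?S" by simp
    show "(if bump q (?v w) \<le> bump p (?u w) then f (?u w) else g (?v w)) = boundary_glue p q f g w"
      using bump0[OF w] cube_split_in(3)[OF w] unfolding boundary_glue_def
      by (smt (verit, best))
  qed
qed

lemma image_subset_boundary_glue:
  assumes f: "f \<in> loop_space p X x0" and g: "g \<in> loop_space q X x0" and "p \<ge> 1" "q \<ge> 1"
  shows "f ` topspace (cube p) \<union> g ` topspace (cube q) \<subseteq> boundary_glue p q f g ` cube_boundary (p + q)"
proof -
  define join where "join u v = (\<lambda>i. if i < p then u i else if i < p + q then v (i - p) else 0)"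
    for u v :: "nat \<Rightarrow> real"
  have split: "cube_split p q (join u v) = (u, v)" if "u \<in> topspace (cube p)" "v \<in> topspace (cube q)" for u v
    using that by (auto simp: cube_split_def join_def topspace_cube fun_eq_iff)
  have inb: "join u v \<in> cube_boundary (p + q)" if u: "u \<in> topspace (cube p)" and v: "v \<in> topspace (cube q)"
    and b: "u \<in> cube_boundary p \<or> v \<in> cube_boundary q" for u v
  proof -
    have "join u v \<in> topspace (cube (p + q))" using u v by (auto simp: join_def topspace_cube)
    moreover have "\<exists>i<p + q. join u v i = 0 \<or> join u v i = 1"
      using b
    proof
      assume "u \<in> cube_boundary p"
      then obtain i where "i < p" "u i = 0 \<or> u i = 1" by (auto simp: cube_boundary_iff)
      then show ?thesis by (intro exI[of _ i]) (auto simp: join_def)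
    next
      assume "v \<in> cube_boundary q"
      then obtain i where "i < q" "v i = 0 \<or> v i = 1" by (auto simp: cube_boundary_iff)
      then show ?thesis by (intro exI[of _ "p + i"]) (auto simp: join_def)
    qed
    ultimately show ?thesis by (simp add: cube_boundary_iff)
  qed
  have o: "(\<lambda>i. 0) \<in> cube_boundary p" "(\<lambda>i. 0) \<in> cube_boundary q"
    using assms(3,4) by (simp_all add: zero_in_cube_boundary)
  have oC: "(\<lambda>i. 0) \<in> topspace (cube p)" "(\<lambda>i. 0) \<in> topspace (cube q)"
    using o by (simp_all add: cube_boundary_iff)
  have "f u \<in> boundary_glue p q f g ` cube_boundary (p + q)" if u: "u \<in> topspace (cube p)" for u
    using inb[OF u oC(2)] split[OF u oC(2)] o(2)
    by (intro image_eqI[of _ _ "join u (\<lambda>i. 0)"]) (auto simp: boundary_glue_def)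
  \<comment> \<open>If v is a boundary point the branch of f is taken, but both values are the base
    point.\<close>
  moreover have "g v \<in> boundary_glue p q f g ` cube_boundary (p + q)" if v: "v \<in> topspace (cube q)" for v
    using inb[OF oC(1) v] split[OF oC(1) v] o(1) loop_spaceD(2)[OF f] loop_spaceD(2)[OF g]
    by (intro image_eqI[of _ _ "join (\<lambda>i. 0) v"]) (auto simp: boundary_glue_def)
  ultimately show ?thesis by blast
qed

lemma loop_space_subtopology:
  assumes "f \<in> loop_space m X x0" "f ` topspace (cube m) \<subseteq> B"
  shows "f \<in> loop_space m (subtopology X B) x0"
  using assms by (auto simp: loop_space_def continuous_map_in_subtopology)

lemma loop_add_cong:
  assumes "m \<ge> 1" "z \<in> topspace (cube m)"
    and "\<And>z. z \<in> topspace (cube m) \<Longrightarrow> F z = F' z" "\<And>z. z \<in> topspace (cube m) \<Longrightarrow> G z = G' z"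
  shows "loop_add F G z = loop_add F' G' z"
  using assms first_half_in_cube[of z m] second_half_in_cube[of z m] by (auto simp: loop_add_def)

text \<open>Continuity and boundary values are read off from the homotopy that constant homotopies
  of the summands induce on the sum.\<close>

lemma loop_add_in_loop_space:
  assumes m: "m \<ge> 1" and f: "f \<in> loop_space m X x0" and g: "g \<in> loop_space m X x0"
  shows "loop_add f g \<in> loop_space m X x0"
proof -
  have const: "homotopic_with (\<lambda>h. \<forall>z\<in>cube_boundary m. h z = x0) (cube m) X h h"
    if "h \<in> loop_space m X x0" for h
    using that by (simp add: homotopic_with_refl loop_space_def)
  have "homotopic_with (\<lambda>h. \<forall>z\<in>cube_boundary m. h z = x0) (cube m) X (loop_add f g) (loop_add f g)"
    using homotopic_loop_add[OF m const[OF f] const[OF g]] .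
  then show ?thesis by (simp add: homotopic_with_refl loop_space_def)
qed

text \<open>All homotopies are made in the subspace \<open>B\<close>, the union of the images of f
  and g, and every point of \<open>B\<close> is a value of the left-hand product; so staying in
  \<open>B\<close> settles the image condition. The inclusions \<open>im\<close> make the other four
  maps loops in \<open>B\<close>.\<close>

lemma whitehead_split_ir_homotopic:
  assumes pq: "p \<ge> 1" "q \<ge> 1" "p + q \<ge> 3" and k: "k < p + q - 1"
    and f: "f \<in> loop_space p X x0" "f1 \<in> loop_space p X x0" "f2 \<in> loop_space p X x0"
    and g: "g \<in> loop_space q X x0" "g1 \<in> loop_space q X x0" "g2 \<in> loop_space q X x0"
    and im: "f1 ` topspace (cube p) \<subseteq> f ` topspace (cube p)" "f2 ` topspace (cube p) \<subseteq> f ` topspace (cube p)"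
      "g1 ` topspace (cube q) \<subseteq> g ` topspace (cube q)" "g2 ` topspace (cube q) \<subseteq> g ` topspace (cube q)"
    and edge1: "\<And>w. w \<in> cube_boundary (p + q) \<Longrightarrow> (\<And>j. j < p + q \<Longrightarrow> j \<noteq> k \<Longrightarrow> w j = 1) \<Longrightarrow> boundary_glue p q f1 g1 w = x0"
    and edge2: "\<And>w. w \<in> cube_boundary (p + q) \<Longrightarrow> (\<And>j. j < p + q \<Longrightarrow> j \<noteq> k \<Longrightarrow> w j = 1) \<Longrightarrow> boundary_glue p q f2 g2 w = x0"
    and split: "\<And>w. w \<in> cube_boundary (p + q) \<Longrightarrow> boundary_glue p q f g w =
      (if w k \<le> 1/2 then boundary_glue p q f1 g1 (w(k := 2 * w k)) else boundary_glue p q f2 g2 (w(k := 2 * w k - 1)))"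
    and glue: "\<And>w. w \<in> cube_boundary (p + q) \<Longrightarrow> w k = 1 \<Longrightarrow>
      boundary_glue p q f1 g1 w = boundary_glue p q f2 g2 (w(k := 0))"
  shows "loop_ir_homotopic (p + q - 1) X x0 (whitehead p q f g)
    (loop_add (whitehead p q f1 g1) (whitehead p q f2 g2))"
proof -
  define m where "m = p + q - 1"
  define B where "B = f ` topspace (cube p) \<union> g ` topspace (cube q)"
  let ?Y = "subtopology X B" and ?C = "topspace (cube m)"
  have m: "Suc m = p + q" "m \<ge> 1" "k < m" using pq k by (auto simp: m_def)
  have fY: "f \<in> loop_space p ?Y x0" "f1 \<in> loop_space p ?Y x0" "f2 \<in> loop_space p ?Y x0"
    "g \<in> loop_space q ?Y x0" "g1 \<in> loop_space q ?Y x0" "g2 \<in> loop_space q ?Y x0"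
    using f g im by (auto intro!: loop_space_subtopology simp: B_def)
  note cont = continuous_map_boundary_glue[where p = p and q = q, folded m(1)]
  have hom: "homotopic_with (\<lambda>h. \<forall>z\<in>cube_boundary m. h z = x0) (cube m) ?Y
      (boundary_glue p q f g \<circ> boundary_param m)
      (loop_add (boundary_glue p q f1 g1 \<circ> boundary_param m) (boundary_glue p q f2 g2 \<circ> boundary_param m))"
    by (rule boundary_split_homotopic[OF m(3) cont cont cont])
      (use fY edge1 edge2 split glue m(1) in \<open>simp_all add: less_Suc_eq_le\<close>)
  note wh = whitehead_eq_boundary_glue[OF m(1)]
  have "homotopic_with (\<lambda>h. \<forall>z\<in>cube_boundary m. h z = x0) (cube m) ?Y (whitehead p q f g)
      (loop_add (whitehead p q f1 g1) (whitehead p q f2 g2))"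
  proof (rule homotopic_with_eq[OF hom])
    fix z assume z: "z \<in> ?C"
    show "whitehead p q f g z = (boundary_glue p q f g \<circ> boundary_param m) z"
      using wh[OF z f(1) g(1)] by simp
    show "loop_add (whitehead p q f1 g1) (whitehead p q f2 g2) z =
        loop_add (boundary_glue p q f1 g1 \<circ> boundary_param m) (boundary_glue p q f2 g2 \<circ> boundary_param m) z"
      using wh[OF _ f(2) g(2)] wh[OF _ f(3) g(3)] by (intro loop_add_cong[OF m(2) z]) auto
  qed (auto simp: cube_boundary_iff)
  moreover have "B \<subseteq> whitehead p q f g ` ?C"
  proof -
    have "B \<subseteq> boundary_glue p q f g ` cube_boundary (Suc m)"
      unfolding B_def m(1) by (rule image_subset_boundary_glue[OF f(1) g(1) pq(1,2)])
    also have "\<dots> = (\<lambda>z. boundary_glue p q f g (boundary_param m z)) ` ?C"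
      unfolding boundary_param_surj[OF m(2), symmetric] image_image ..
    also have "\<dots> = whitehead p q f g ` ?C" using wh[OF _ f(1) g(1)] by (intro image_cong) auto
    finally show ?thesis .
  qed
  ultimately show ?thesis
    unfolding m_def[symmetric] by (intro loop_ir_homotopicI[OF m(2)]) auto
qed

section \<open>Additivity in each variable\<close>

lemma image_subset_loop_add:
  assumes m: "m \<ge> 1" and f: "f \<in> loop_space m X x0" and g: "g \<in> loop_space m X x0"
  shows "f ` topspace (cube m) \<subseteq> loop_add f g ` topspace (cube m)"
    and "g ` topspace (cube m) \<subseteq> loop_add f g ` topspace (cube m)"
proof -
  show "f ` topspace (cube m) \<subseteq> loop_add f g ` topspace (cube m)"
  proof (rule image_subsetI)
    fix z assume "z \<in> topspace (cube m)"
    then show "f z \<in> loop_add f g ` topspace (cube m)"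
      using m by (intro image_eqI[of _ _ "z(0 := z 0 / 2)"]) (auto simp: loop_add_def topspace_cube)
  qed
  show "g ` topspace (cube m) \<subseteq> loop_add f g ` topspace (cube m)"
  proof (rule image_subsetI)
    fix z assume z: "z \<in> topspace (cube m)"
    then have z0: "0 \<le> z 0" "z 0 \<le> 1" using m by (auto simp: topspace_cube)
    have in_C: "z(0 := (1 + z 0) / 2) \<in> topspace (cube m)" using z m by (auto simp: topspace_cube)
    \<comment> \<open>For z 0 = 0 the new coordinate is 1/2, where \<open>loop_add\<close> takes the
      branch of f; both values are the base point.\<close>
    have "g z = loop_add f g (z(0 := (1 + z 0) / 2))"
    proof (cases "z 0 = 0")
      case True
      then have "z \<in> cube_boundary m" "z(0 := 1) \<in> cube_boundary m"
        using z m by (auto simp: cube_boundary_iff topspace_cube intro!: exI[of _ 0])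
      then show ?thesis using True loop_spaceD(2)[OF f] loop_spaceD(2)[OF g] by (simp add: loop_add_def)
    next
      case False
      then have "2 * ((1 + z 0) / 2) - 1 = z 0" "\<not> (1 + z 0) / 2 \<le> 1/2" using z0 by (auto simp: field_simps)
      then show ?thesis by (simp add: loop_add_def)
    qed
    then show "g z \<in> loop_add f g ` topspace (cube m)" using in_C by blast
  qed
qed

lemma cube_split_upd_fst: "i < p \<Longrightarrow> cube_split p q (w(i := c)) = ((fst (cube_split p q w))(i := c), snd (cube_split p q w))"
  by (auto simp: cube_split_def fun_eq_iff)

lemma cube_split_upd_snd: "i < q \<Longrightarrow> cube_split p q (w(p + i := c)) = (fst (cube_split p q w), (snd (cube_split p q w))(i := c))"
  by (auto simp: cube_split_def fun_eq_iff)

lemma upd_1_in_cube_boundary: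
  assumes "z \<in> topspace (cube m)" "z 0 = 1" "m \<ge> 1"
  shows "z \<in> cube_boundary m" "z(0 := 0) \<in> cube_boundary m"
  using assms by (auto simp: cube_boundary_iff topspace_cube intro!: exI[of _ 0])

text \<open>The cut is along coordinate 0. On the corner edge, coordinate p puts the second
  component on its boundary, and coordinate 1, available as p is at least 2, does so for the
  first.\<close>

proposition whitehead_loop_add_left:
  assumes pq: "p \<ge> 2" "q \<ge> 1"
    and f: "f1 \<in> loop_space p X x0" "f2 \<in> loop_space p X x0" and g: "g \<in> loop_space q X x0"
  shows "loop_ir_homotopic (p + q - 1) X x0 (whitehead p q (loop_add f1 f2) g)
    (loop_add (whitehead p q f1 g) (whitehead p q f2 g))"
proof (rule whitehead_split_ir_homotopic[where k = 0])
  show "loop_add f1 f2 \<in> loop_space p X x0" using pq f by (intro loop_add_in_loop_space) auto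
  show "f1 ` topspace (cube p) \<subseteq> loop_add f1 f2 ` topspace (cube p)"
    "f2 ` topspace (cube p) \<subseteq> loop_add f1 f2 ` topspace (cube p)"
    by (rule image_subset_loop_add[OF _ f]; use pq in simp)+
  have edge: "boundary_glue p q h g w = x0" if h: "h \<in> loop_space p X x0" and w: "w \<in> cube_boundary (p + q)"
    and one: "\<And>j. j < p + q \<Longrightarrow> j \<noteq> 0 \<Longrightarrow> w j = 1" for h w
  proof -
    have "snd (cube_split p q w) \<in> cube_boundary q"
      using cube_split_in(2)[OF w] one[of p] pq unfolding cube_boundary_iff
      by (intro conjI exI[of _ 0]) (auto simp: cube_split_def)
    moreover have "fst (cube_split p q w) \<in> cube_boundary p"
      using cube_split_in(1)[OF w] one[of 1] pq unfolding cube_boundary_iff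
      by (intro conjI exI[of _ 1]) (auto simp: cube_split_def)
    ultimately show ?thesis using loop_spaceD(2)[OF h] by (simp add: boundary_glue_def)
  qed
  show "boundary_glue p q f1 g w = x0" "boundary_glue p q f2 g w = x0"
    if "w \<in> cube_boundary (p + q)" "\<And>j. j < p + q \<Longrightarrow> j \<noteq> 0 \<Longrightarrow> w j = 1" for w
    using edge[OF _ that] f by blast+
  show "boundary_glue p q (loop_add f1 f2) g w =
      (if w 0 \<le> 1/2 then boundary_glue p q f1 g (w(0 := 2 * w 0)) else boundary_glue p q f2 g (w(0 := 2 * w 0 - 1)))"
    if "w \<in> cube_boundary (p + q)" for w
  proof -
    have "fst (cube_split p q w) 0 = w 0" using pq by (simp add: cube_split_def)
    then show ?thesis using pq by (simp add: boundary_glue_def cube_split_upd_fst loop_add_def)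
  qed
  show "boundary_glue p q f1 g w = boundary_glue p q f2 g (w(0 := 0))"
    if w: "w \<in> cube_boundary (p + q)" and w1: "w 0 = 1" for w
  proof -
    have "fst (cube_split p q w) 0 = 1" using pq w1 by (simp add: cube_split_def)
    then show ?thesis
      using pq upd_1_in_cube_boundary[OF cube_split_in(1)[OF w]] loop_spaceD(2)[OF f(1)] loop_spaceD(2)[OF f(2)]
      by (simp add: boundary_glue_def cube_split_upd_fst)
  qed
qed (use pq f g in auto)

text \<open>The cut is along coordinate p, the first one of the second factor; as q is at least 2,
  coordinate p + 1 remains to put the second component on its boundary.\<close>

proposition whitehead_loop_add_right:
  assumes pq: "p \<ge> 1" "q \<ge> 2"
    and f: "f \<in> loop_space p X x0" and g: "g1 \<in> loop_space q X x0" "g2 \<in> loop_space q X x0"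
  shows "loop_ir_homotopic (p + q - 1) X x0 (whitehead p q f (loop_add g1 g2))
    (loop_add (whitehead p q f g1) (whitehead p q f g2))"
proof (rule whitehead_split_ir_homotopic[where k = p])
  show "loop_add g1 g2 \<in> loop_space q X x0" using pq g by (intro loop_add_in_loop_space) auto
  show "g1 ` topspace (cube q) \<subseteq> loop_add g1 g2 ` topspace (cube q)"
    "g2 ` topspace (cube q) \<subseteq> loop_add g1 g2 ` topspace (cube q)"
    by (rule image_subset_loop_add[OF _ g]; use pq in simp)+
  have upd: "cube_split p q (w(p := c)) = (fst (cube_split p q w), (snd (cube_split p q w))(0 := c))" for w c
    using cube_split_upd_snd[of 0 q p w c] pq by simp
  have v0: "snd (cube_split p q w) 0 = w p" for w using pq by (simp add: cube_split_def)
  show "boundary_glue p q f g1 w = x0" "boundary_glue p q f g2 w = x0"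
    if w: "w \<in> cube_boundary (p + q)" and one: "\<And>j. j < p + q \<Longrightarrow> j \<noteq> p \<Longrightarrow> w j = 1" for w
  proof -
    have "snd (cube_split p q w) \<in> cube_boundary q"
      using cube_split_in(2)[OF w] one[of "p + 1"] pq unfolding cube_boundary_iff
      by (intro conjI exI[of _ 1]) (auto simp: cube_split_def)
    moreover have "fst (cube_split p q w) \<in> cube_boundary p"
      using cube_split_in(1)[OF w] one[of 0] pq unfolding cube_boundary_iff
      by (intro conjI exI[of _ 0]) (auto simp: cube_split_def)
    ultimately show "boundary_glue p q f g1 w = x0" "boundary_glue p q f g2 w = x0"
      using loop_spaceD(2)[OF f] by (simp_all add: boundary_glue_def)
  qed
  show "boundary_glue p q f (loop_add g1 g2) w =
      (if w p \<le> 1/2 then boundary_glue p q f g1 (w(p := 2 * w p)) else boundary_glue p q f g2 (w(p := 2 * w p - 1)))"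
    if w: "w \<in> cube_boundary (p + q)" for w
  \<comment> \<open>Unlike in the first variable, rescaling changes the component that decides the
    branch. A boundary point stays one, so the value remains that of f. An interior point may land
    on the boundary of its half, but there f gives the base point, since the first component is a
    boundary point.\<close>
  proof (cases "snd (cube_split p q w) \<in> cube_boundary q")
    case True
    then show ?thesis
      using half_in_cube_boundary[OF True] by (simp add: boundary_glue_def upd v0)
  next
    case False
    then have "f (fst (cube_split p q w)) = x0"
      using cube_split_in(3)[OF w] loop_spaceD(2)[OF f] by blast
    with False show ?thesis
      using loop_spaceD(2)[OF g(1)] loop_spaceD(2)[OF g(2)] by (simp add: boundary_glue_def upd v0 loop_add_def)
  qed
  show "boundary_glue p q f g1 w = boundary_glue p q f g2 (w(p := 0))"
    if w: "w \<in> cube_boundary (p + q)" and w1: "w p = 1" for w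
    using upd_1_in_cube_boundary[OF cube_split_in(2)[OF w]] pq w1 by (simp add: boundary_glue_def upd v0)
qed (use pq f g in auto)

theorem proposition3p3:
  fixes X :: "'a topology" and x0 :: 'a and p q :: nat
    and f1 f2 g1 g2 :: "(nat \<Rightarrow> real) \<Rightarrow> 'a"
  assumes "p \<ge> 2" and "q \<ge> 2"
    and "Hausdorff_space X" and "x0 \<in> topspace X"
    and "f1 \<in> loop_space p X x0" and "f2 \<in> loop_space p X x0"
    and "g1 \<in> loop_space q X x0" and "g2 \<in> loop_space q X x0"
  shows "loop_ir_homotopic (p + q - 1) X x0
           (whitehead p q (loop_add f1 f2) g1)
           (loop_add (whitehead p q f1 g1) (whitehead p q f2 g1)) \<and>
         loop_ir_homotopic (p + q - 1) X x0
           (whitehead p q f1 (loop_add g1 g2))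
           (loop_add (whitehead p q f1 g1) (whitehead p q f1 g2))"
  by (intro conjI whitehead_loop_add_left whitehead_loop_add_right) (use assms in auto)

end
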